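(* Let $(X,d,\mu)$ be an $s$-Ahlfors-regular quasi-metric measure space. Then for all $1<q\le\infty$ and all $v>-1$, $$B^{0,v}_q(X)\subsetneq L(\log^+ L)^{1+v}(X),$$ i.e. every function in the block space $B^{0,v}_q(X)$ belongs to $L(\log^+ L)^{1+v}(X)$, and there is a function in $L(\log^+ L)^{1+v}(X)$ that does not belong to $B^{0,v}_q(X)$.
   Context: An $s$-Ahlfors-regular quasi-metric measure space $(X,d,\mu)$ is a set $X$ (with at least two points) with a function $d:X\times X\to[0,\infty)$ such that $d(x,y)=d(y,x)$; $d(x,y)=0$ iff $x=y$; and for some constant $A\ge 1$, $d(x,y)\le A(d(x,z)+d(z,y))$ for all $x,y,z\in X$; together with a nonzero Borel regular measure $\mu$ on $X$ for which there are constants $c,C,s>0$ with $$c\,r^s\le\mu(B(x,r))\le C\,r^s,\qquad x\in X,\ 0<r<\operatorname{diam}(X),$$ where $B(x,r)=\{y\in X:d(x,y)<r\}$ (a ball) and $\operatorname{diam}(X)=\sup\{d(x,y):x,y\in X\}\in[0,\infty]$. Balls are understood to be $\mu$-measurable. Write $\log^+t=\max\{\log t,0\}$, and let $q'$ be the conjugate exponent of $q$ ($\infty'=1$). For $k\ge0$, $v>-1$, $t>0$ set $\phi_{k,v}(t)=\chi_{(0,1)}(t)\int_t^1 s^{-1-k}(\log^+(1/s))^v\,ds$; in particular $\phi_{0,v}(t)=\frac1{1+v}(\log^+(1/t))^{1+v}$. $q$-block: for $1<q\le\infty$, a measurable function $a$ on $X$ is a $q$-block (supported on $B$) if $B\subset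 X$ is a ball with $0<\mu(B)<\infty$, $\operatorname{supp}a\subseteq B$ (i.e. $a$ vanishes outside $B$), and $\|a\|_{L^q(B)}\le\mu(B)^{-1/q'}$. Block space $B^{0,v}_q(X)$: all $f\in L^1(X)$ admitting a decomposition $f=\sum_{j=1}^\infty\lambda_ja_j$ with $\lambda_j\in\mathbb C$, each $a_j$ a $q$-block supported on a ball $B_j$, and $\sum_{j=1}^\infty|\lambda_j|(1+\phi_{0,v}(\mu(B_j)))<\infty$. (Since $\|a_j\|_{L^1}\le1$, the series converges absolutely in $L^1(X)$.) Orlicz-type space: for $\beta>0$, $L(\log^+L)^\beta(X)$ is the set of measurable $f$ on $X$ with $\int_X|f|(\log(2+|f|))^\beta\,d\mu<\infty$. *)

theory Defs
  imports "HOL-Analysis.Analysis" "HOL-Probability.Essential_Supremum"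
begin

definition quasi_metric_on :: "'a set \<Rightarrow> ('a \<Rightarrow> 'a \<Rightarrow> real) \<Rightarrow> bool" where
  "quasi_metric_on X d \<longleftrightarrow>
     (\<forall>x\<in>X. \<forall>y\<in>X. 0 \<le> d x y \<and> d x y = d y x \<and> (d x y = 0 \<longleftrightarrow> x = y)) \<and>
     (\<exists>A\<ge>1. \<forall>x\<in>X. \<forall>y\<in>X. \<forall>z\<in>X. d x y \<le> A * (d x z + d z y))"

definition qball :: "'a set \<Rightarrow> ('a \<Rightarrow> 'a \<Rightarrow> real) \<Rightarrow> 'a \<Rightarrow> real \<Rightarrow> 'a set" where
  "qball X d x r = {y \<in> X. d x y < r}"

definition qdiam :: "'a set \<Rightarrow> ('a \<Rightarrow> 'a \<Rightarrow> real) \<Rightarrow> ennreal" where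
  "qdiam X d = (SUP x\<in>X. SUP y\<in>X. ennreal (d x y))"

definition qm_open :: "'a set \<Rightarrow> ('a \<Rightarrow> 'a \<Rightarrow> real) \<Rightarrow> 'a set \<Rightarrow> bool" where
  "qm_open X d U \<longleftrightarrow> U \<subseteq> X \<and> (\<forall>x\<in>U. \<exists>r>0. qball X d x r \<subseteq> U)"

definition qm_borel :: "'a set \<Rightarrow> ('a \<Rightarrow> 'a \<Rightarrow> real) \<Rightarrow> 'a set set" where
  "qm_borel X d = sigma_sets X {U. qm_open X d U}"

text \<open>The \<open>\<sigma>\<close>-algebra of \<open>M\<close> may be larger than the Borel \<open>\<sigma>\<close>-algebra (for instance the sets
  that are Caratheodory-measurable for a Borel regular outer measure).\<close>

definition borel_regular_on :: "'a set \<Rightarrow> ('a \<Rightarrow> 'a \<Rightarrow> real) \<Rightarrow> 'a measure \<Rightarrow> bool" where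
  "borel_regular_on X d M \<longleftrightarrow>
     space M = X \<and> qm_borel X d \<subseteq> sets M \<and>
     (\<forall>E\<in>sets M. \<exists>F\<in>qm_borel X d. E \<subseteq> F \<and> emeasure M F = emeasure M E)"

text \<open>Balls need not be open for a quasi-metric, so their measurability is a separate requirement.\<close>

definition ahlfors_regular_qmms ::
    "real \<Rightarrow> 'a set \<Rightarrow> ('a \<Rightarrow> 'a \<Rightarrow> real) \<Rightarrow> 'a measure \<Rightarrow> bool" where
  "ahlfors_regular_qmms s X d M \<longleftrightarrow>
     (\<exists>x\<in>X. \<exists>y\<in>X. x \<noteq> y) \<and>
     quasi_metric_on X d \<and>
     borel_regular_on X d M \<and>
     emeasure M X \<noteq> 0 \<and>
     (\<forall>x\<in>X. \<forall>r>0. qball X d x r \<in> sets M) \<and>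
     s > 0 \<and>
     (\<exists>c>0. \<exists>C>0. \<forall>x\<in>X. \<forall>r>0. ennreal r < qdiam X d \<longrightarrow>
        ennreal (c * r powr s) \<le> emeasure M (qball X d x r) \<and>
        emeasure M (qball X d x r) \<le> ennreal (C * r powr s))"

definition log_plus :: "real \<Rightarrow> real" where
  "log_plus t = max (ln t) 0"

definition block_phi :: "real \<Rightarrow> real \<Rightarrow> real \<Rightarrow> real" where
  "block_phi k v t =
     indicator {0<..<1} t * (LBINT s=t..1. s powr (-1 - k) * log_plus (1 / s) powr v)"

lemma block_phi_0:
  assumes v: "v > -1" and t: "0 < t" "t < 1"
  shows "block_phi 0 v t = log_plus (1/t) powr (1+v) / (1+v)"
proof -
  let ?F = "\<lambda>s. - (ln (1/s) powr (1+v) / (1+v))"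
  have p: "ln (1/s) > 0" if "t < s" "s < 1" for s using that t by simp
  have D: "DERIV ?F s :> s powr (-1-0) * log_plus (1/s) powr v" if "t < s" "s < 1" for s
  proof -
    have "s > 0" using that t by simp
    have [simp]: "log_plus (1/s) = ln (1/s)" using p[OF that] by (simp add: log_plus_def)
    obtain w where w: "w = 1+v" "w > 0" using v by auto
    have "((\<lambda>s. ln (1/s) powr w / w) has_real_derivative (- (ln (1/s) powr (w-1) / s))) (at s)"
      using p[OF that] \<open>s>0\<close> w(2)
      by (auto intro!: derivative_eq_intros simp: divide_simps powr_diff power2_eq_square)
    from DERIV_minus[OF this] show ?thesis using v \<open>s>0\<close> w
      by (simp add: powr_minus divide_simps)
  qed
  have C: "isCont (\<lambda>s. s powr (-1-0) * log_plus (1/s) powr v) s" if "t < s" "s < 1" for s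
    unfolding log_plus_def using p[OF that] t that by (intro continuous_intros) auto
  have c: "continuous_on {t..1} ?F"
    using t v by (intro continuous_intros continuous_on_powr') auto
  have "(LBINT s=ereal t..ereal 1. s powr (-1 - 0) * log_plus (1 / s) powr v) = ?F 1 - ?F t"
  proof (rule interval_integral_FTC_nonneg[where F="?F"])
    show "((?F \<circ> real_of_ereal) \<longlongrightarrow> ?F 1) (at_left (ereal 1))"
      unfolding ereal_tendsto_simps1 using continuous_on_Icc_at_leftD[OF c t(2)] .
    show "((?F \<circ> real_of_ereal) \<longlongrightarrow> ?F t) (at_right (ereal t))"
      unfolding ereal_tendsto_simps1 using continuous_on_Icc_at_rightD[OF c t(2)] .
  qed (use D C t in \<open>simp_all add: log_plus_def\<close>)
  then show ?thesis using t v by (simp add: block_phi_def log_plus_def one_ereal_def)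
qed

definition conj_exponent :: "ereal \<Rightarrow> real" where
  "conj_exponent q = (if q = \<infinity> then 1 else real_of_ereal q / (real_of_ereal q - 1))"

definition Lq_norm_on :: "ereal \<Rightarrow> 'a measure \<Rightarrow> 'a set \<Rightarrow> ('a \<Rightarrow> complex) \<Rightarrow> ennreal" where
  "Lq_norm_on q M B a =
     (if q = \<infinity> then esssup (restrict_space M B) (\<lambda>x. ennreal (cmod (a x)))
      else let I = (\<integral>\<^sup>+x\<in>B. ennreal (cmod (a x) powr real_of_ereal q) \<partial>M)
           in if I = \<infinity> then \<infinity> else ennreal (enn2real I powr (1 / real_of_ereal q)))"

definition q_block ::
    "'a set \<Rightarrow> ('a \<Rightarrow> 'a \<Rightarrow> real) \<Rightarrow> 'a measure \<Rightarrow> ereal \<Rightarrow> 'a set \<Rightarrow> ('a \<Rightarrow> complex) \<Rightarrow> bool" where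
  "q_block X d M q B a \<longleftrightarrow>
     a \<in> borel_measurable M \<and>
     (\<exists>x\<in>X. \<exists>r>0. B = qball X d x r) \<and>
     0 < emeasure M B \<and> emeasure M B < \<infinity> \<and>
     (\<forall>x\<in>X - B. a x = 0) \<and>
     Lq_norm_on q M B a \<le> ennreal (measure M B powr (- 1 / conj_exponent q))"

text \<open>The block space \<open>B\<^sup>0\<^sup>,\<^sup>v\<^sub>q(X)\<close>, as a set of functions rather than of classes modulo null sets;
  the sum of the series \<open>\<Sum>\<^sub>j \<lambda>\<^sub>j a\<^sub>j\<close> is taken in \<open>L\<^sup>1\<close>, so membership is invariant under measurable
  modification on null sets.\<close>

definition block_space ::
    "'a set \<Rightarrow> ('a \<Rightarrow> 'a \<Rightarrow> real) \<Rightarrow> 'a measure \<Rightarrow> ereal \<Rightarrow> real \<Rightarrow> ('a \<Rightarrow> complex) set" where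
  "block_space X d M q v =
     {f. integrable M f \<and>
         (\<exists>(l :: nat \<Rightarrow> complex) a B.
            (\<forall>j. q_block X d M q (B j) (a j)) \<and>
            summable (\<lambda>j. cmod (l j) * (1 + block_phi 0 v (measure M (B j)))) \<and>
            (\<lambda>n. \<integral>\<^sup>+x. ennreal (cmod (f x - (\<Sum>j<n. l j * a j x))) \<partial>M) \<longlonglongrightarrow> 0)}"

definition LlogL_space :: "'a measure \<Rightarrow> real \<Rightarrow> ('a \<Rightarrow> complex) set" where
  "LlogL_space M \<beta> =
     {f. f \<in> borel_measurable M \<and>
         (\<integral>\<^sup>+x. ennreal (cmod (f x) * ln (2 + cmod (f x)) powr \<beta>) \<partial>M) < \<infinity>}"

end

theory Submission
  imports Defs "HOL-Real_Asymp.Real_Asymp"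
begin

text \<open>
  For the inclusion, a \<open>q\<close>-block \<open>a\<close> on \<open>B\<close> has
  \<open>\<integral> |a| (ln (2 + |a|))\<^bsup>1+v\<^esup> \<le> C (1 + \<phi>(\<mu>(B)))\<close>, and these bounds are added up along \<open>\<Sum>\<^sub>j |\<lambda>\<^sub>j| |a\<^sub>j|\<close>.

  For the strictness, let \<open>E\<close> be a union of tiny balls centred at a maximal \<open>e\<close>-separated subset of a
  fixed ball, of total measure about \<open>t\<close>. On balls of radius at least \<open>e\<close> the set \<open>E\<close> has density at most
  about \<open>t\<close>, so that \<open>w 1\<^sub>E\<close> with \<open>w = t\<^bsup>-1/q'\<^esup>\<close> (\<open>\<infinity>\<close>-blocks being
  treated as \<open>2\<close>-blocks) has bounded pairing with the blocks on such balls; for smaller balls the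
  pairing is at most \<open>2 w\<close>, which is below \<open>2 \<phi>(\<mu>(B))\<close> once \<open>e\<close> is small enough. Hence \<open>\<integral> |f| w 1\<^sub>E\<close> is bounded uniformly in \<open>t\<close> for \<open>f\<close> in the block space, while
  for \<open>f = \<alpha> 1\<^sub>E\<close> of unit size in \<open>L(log\<^sup>+L)\<^bsup>1+v\<^esup>\<close> it grows like a power of \<open>1/t\<close> up to
  logarithms. A supremum of such functions along a sequence \<open>t \<rightarrow> 0\<close> is the required example.
\<close>

section \<open>Elementary inequalities\<close>

lemma ln_powr_le_powr:
  fixes b e x :: real
  assumes "0 < b" "0 < e" "1 \<le> x"
  shows "ln x powr b \<le> (b / e) powr b * x powr e"
proof -
  have "ln x powr b \<le> (x powr (e / b) / (e / b)) powr b"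
    using assms ln_powr_bound[of x "e / b"] by (intro powr_mono2) auto
  also have "\<dots> = (b / e) powr b * x powr e"
    using assms by (subst powr_divide) (auto simp: powr_powr powr_divide)
  finally show ?thesis .
qed

text \<open>If \<open>y\<close> is at most \<open>(2 + x)^2\<close>, the two logarithms are
  comparable up to a factor 3. Otherwise \<open>x\<close> is at most \<open>sqrt y\<close>, and the
  logarithm is absorbed by the remaining square root of \<open>y\<close>. This exchanges the
  logarithm of a whole sum for that of a single summand.\<close>

lemma LlogL_mixed_bound:
  fixes b :: real
  assumes "0 < b"
  obtains K where "K > 0"
    "\<And>x y. 0 \<le> x \<Longrightarrow> 0 \<le> y \<Longrightarrow> x * ln (2 + y) powr b \<le> K * (x * ln (2 + x) powr b + y)"
proof
  define K1 where "K1 = (b / (1/2)) powr b"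
  have K1: "K1 > 0" using assms by (simp add: K1_def)
  let ?K = "3 powr b + 2 * K1"
  show "?K > 0" using K1 by (simp add: add_pos_pos)
  fix x y :: real assume x: "0 \<le> x" and y: "0 \<le> y"
  have P: "0 \<le> x * ln (2 + x) powr b" using x by simp
  show "x * ln (2 + y) powr b \<le> ?K * (x * ln (2 + x) powr b + y)"
  proof (cases "y \<le> (2 + x)\<^sup>2")
    case True
    have "2 + y \<le> (2 + x) ^ 3"
      using True x by (auto simp: power2_eq_square power3_eq_cube algebra_simps intro: order_trans)
    then have "ln (2 + y) \<le> ln ((2 + x) ^ 3)" using x y by (subst ln_le_cancel_iff) auto
    also have "\<dots> = 3 * ln (2 + x)" using x by (simp add: ln_realpow)
    finally have "ln (2 + y) powr b \<le> (3 * ln (2 + x)) powr b"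
      using assms y by (intro powr_mono2) auto
    also have "\<dots> = 3 powr b * ln (2 + x) powr b" using x by (simp add: powr_mult)
    finally have "x * ln (2 + y) powr b \<le> 3 powr b * (x * ln (2 + x) powr b)"
      using x by (metis mult.left_commute mult_left_mono)
    also have "\<dots> \<le> ?K * (x * ln (2 + x) powr b + y)"
      using P y K1 by (intro mult_mono) auto
    finally show ?thesis .
  next
    case False
    moreover have "4 + x\<^sup>2 \<le> (2 + x)\<^sup>2" using x by (simp add: power2_sum)
    ultimately have y4': "4 + x\<^sup>2 \<le> y" by linarith
    then have y4: "4 \<le> y" using zero_le_power2[of x] by linarith
    have xy: "x \<le> sqrt y" using y4' by (intro real_le_rsqrt) auto
    have "x * ln (2 + y) powr b \<le> sqrt y * (K1 * (2 + y) powr (1/2))"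
      unfolding K1_def using assms x y xy by (intro mult_mono ln_powr_le_powr) auto
    also have "(2 + y) powr (1/2) = sqrt (2 + y)" using y by (simp add: powr_half_sqrt)
    also have "sqrt y * (K1 * sqrt (2 + y)) \<le> sqrt y * (K1 * sqrt (4 * y))"
      using y4 K1 by (intro mult_left_mono) auto
    also have "\<dots> = 2 * K1 * y" using y by (simp add: real_sqrt_mult)
    also have "\<dots> \<le> ?K * (x * ln (2 + x) powr b + y)"
      using P y K1 by (intro mult_mono) auto
    finally show ?thesis .
  qed
qed

lemma block_phi_nonneg:
  assumes "v > -1" "0 < t"
  shows "0 \<le> block_phi 0 v t"
proof (cases "t < 1")
  case True
  then show ?thesis using assms by (subst block_phi_0) auto
qed (simp add: block_phi_def)

text \<open>Below 1 the function \<open>block_phi 0 v\<close> is a constant multiple of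
  \<open>ln (1/t) powr (1+v)\<close>. From 1 on it vanishes, and the left side is at most
  \<open>ln 3 powr (1+v)\<close>, which the summand 1 absorbs.\<close>

lemma ln_powr_le_block_phi:
  fixes v :: real
  assumes v: "v > -1"
  obtains K where "K > 0"
    "\<And>t. 0 < t \<Longrightarrow> ln (2 + 1 / t) powr (1 + v) \<le> K * (1 + block_phi 0 v t)"
proof
  let ?b = "1 + v"
  let ?K = "2 powr ?b * (ln 3 powr ?b + ?b)"
  have b: "?b > 0" using v by simp
  show "?K > 0" using b by (auto intro!: mult_pos_pos add_nonneg_pos simp del: zero_less_mult_iff)
  fix t :: real assume t: "0 < t"
  show "ln (2 + 1 / t) powr ?b \<le> ?K * (1 + block_phi 0 v t)"
  proof (cases "t < 1")
    case False
    have "ln (2 + 1 / t) powr ?b \<le> 1 * ln 3 powr ?b"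
      using False t b by (simp, intro powr_mono2) (auto simp: field_simps)
    also have "\<dots> \<le> 2 powr ?b * (ln 3 powr ?b + ?b)"
      using b by (intro mult_mono ge_one_powr_ge_zero) auto
    finally show ?thesis using False by (simp add: block_phi_def)
  next
    case True
    let ?l = "ln (1 / t)"
    have l: "?l \<ge> 0" using True t by simp
    have "2 + 1 / t \<le> 3 * (1 / t)" using True t by (simp add: field_simps)
    then have "ln (2 + 1 / t) \<le> ln (3 * (1 / t))" using t by (subst ln_le_cancel_iff) (auto simp: add_pos_pos)
    also have "\<dots> = ln 3 + ?l" using t by (subst ln_mult) auto
    also have "\<dots> \<le> 2 * max (ln 3) ?l" by simp
    finally have "ln (2 + 1 / t) powr ?b \<le> (2 * max (ln 3) ?l) powr ?b"
      using b t by (intro powr_mono2) auto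
    also have "\<dots> = 2 powr ?b * max (ln 3) ?l powr ?b" using l by (subst powr_mult) auto
    also have "\<dots> \<le> 2 powr ?b * (ln 3 powr ?b + ?l powr ?b)"
      by (intro mult_left_mono) (auto simp: max_def)
    also have "?l powr ?b = ?b * block_phi 0 v t"
      using v t True l by (simp add: block_phi_0 log_plus_def)
    also have "2 powr ?b * (ln 3 powr ?b + ?b * block_phi 0 v t) \<le> ?K * (1 + block_phi 0 v t)"
    proof -
      have "x + ?b * y \<le> (x + ?b) * (1 + y)" if "0 \<le> x" "0 \<le> y" for x y
      proof -
        have "(x + ?b) * (1 + y) = x + ?b * y + (?b + x * y)" by (simp add: algebra_simps)
        then show ?thesis using that b by simp
      qed
      from this[of "ln 3 powr ?b" "block_phi 0 v t"] show ?thesis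
        using block_phi_nonneg[OF v t] by (simp add: mult.assoc)
    qed
    finally show ?thesis .
  qed
qed

text \<open>Heights are measured in units of \<open>1/m\<close>, with \<open>t = m * y\<close>.
  Since \<open>2 + y\<close> is at most \<open>(2 + t) * (2 + 1/m)\<close> and both logarithms are
  at least \<open>ln 2\<close>, their sum is bounded by a multiple of their product. The factor in
  \<open>1/m\<close> yields \<open>block_phi\<close>; the factor in \<open>t\<close> is absorbed by
  the power \<open>p > 1\<close>.\<close>

lemma LlogL_block_bound:
  fixes p v :: real
  assumes p: "p > 1" and v: "v > -1"
  obtains K where "K > 0"
    "\<And>m y. 0 < m \<Longrightarrow> 0 \<le> y \<Longrightarrow>
       y * ln (2 + y) powr (1 + v) \<le> K * (1 + block_phi 0 v m) * (1 / m * (1 + (m * y) powr p))"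
proof -
  let ?b = "1 + v"
  have b: "?b > 0" using v by simp
  obtain K1 where K1: "K1 > 0"
    "\<And>t. 0 < t \<Longrightarrow> ln (2 + 1 / t) powr ?b \<le> K1 * (1 + block_phi 0 v t)"
    using ln_powr_le_block_phi[OF v] by blast
  define K2 where "K2 = (?b / (p - 1)) powr ?b"
  have K2: "K2 > 0" using b p by (simp add: K2_def)
  let ?c = "(2 / ln 2) powr ?b"
  show thesis
  proof
    show "?c * K1 * K2 * 4 powr p > 0" using K1 K2 by simp
    fix m y :: real assume m: "0 < m" and y: "0 \<le> y"
    define t where "t = m * y"
    have t: "t \<ge> 0" using m y by (simp add: t_def)
    have yt: "y = t / m" using m by (simp add: t_def)
    let ?u = "ln (2 + t)" and ?w = "ln (2 + 1 / m)"
    have u: "?u \<ge> ln 2" and w: "?w \<ge> ln 2" using t m by (auto simp: add_pos_pos)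
    have u0: "?u \<ge> 0" and w0: "?w \<ge> 0" using t m by auto
    have l2: "ln 2 > (0::real)" by simp
    have "t * ?u powr ?b \<le> (2 + t) * (K2 * (2 + t) powr (p - 1))"
      unfolding K2_def using t b p by (intro mult_mono ln_powr_le_powr) auto
    also have "\<dots> = K2 * (2 + t) powr p" using t by (simp add: powr_diff)
    also have "(2 + t) powr p \<le> 4 powr p * (1 + t powr p)"
    proof (cases "t \<le> 1")
      case True
      then have "(2 + t) powr p \<le> 4 powr p" using t p by (intro powr_mono2) auto
      then show ?thesis by (simp add: algebra_simps add_increasing2)
    next
      case False
      then have "(2 + t) powr p \<le> (4 * t) powr p" using t p by (intro powr_mono2) auto
      also have "\<dots> = 4 powr p * t powr p" using t by (simp add: powr_mult)
      also have "\<dots> \<le> 4 powr p * (1 + t powr p)" by (intro mult_left_mono) auto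
      finally show ?thesis .
    qed
    finally have tu: "t * ?u powr ?b \<le> K2 * 4 powr p * (1 + t powr p)" using K2 by (simp add: mult.assoc)
    have "2 + y \<le> (2 + t) * (2 + 1 / m)" using t m by (simp add: yt field_simps)
    then have "ln (2 + y) \<le> ln ((2 + t) * (2 + 1 / m))"
      using y t m by (subst ln_le_cancel_iff) (auto intro!: mult_pos_pos add_pos_pos)
    also have "\<dots> = ?u + ?w" using t m by (subst ln_mult) (auto simp: add_nonneg_eq_0_iff)
    also have "\<dots> \<le> 2 / ln 2 * (?u * ?w)"
    proof -
      have "ln 2 * ?u \<le> ?w * ?u" using w u0 by (rule mult_right_mono)
      moreover have "ln 2 * ?w \<le> ?u * ?w" using u w0 by (rule mult_right_mono)
      ultimately have "ln 2 * (?u + ?w) \<le> 2 * (?u * ?w)" by (simp add: algebra_simps)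
      then show ?thesis using l2 by (simp add: pos_le_divide_eq mult.commute)
    qed
    finally have "ln (2 + y) powr ?b \<le> (2 / ln 2 * (?u * ?w)) powr ?b"
      using b y by (intro powr_mono2) auto
    also have "\<dots> = ?c * (?u powr ?b * ?w powr ?b)"
      using u0 w0 l2 by (simp add: powr_mult powr_divide)
    finally have "y * ln (2 + y) powr ?b \<le> y * (?c * (?u powr ?b * ?w powr ?b))"
      using y by (rule mult_left_mono)
    also have "\<dots> = ?c * ?w powr ?b * (1 / m) * (t * ?u powr ?b)"
      by (simp add: yt)
    also have "\<dots> \<le> ?c * (K1 * (1 + block_phi 0 v m)) * (1 / m) * (K2 * 4 powr p * (1 + t powr p))"
      using t m K1(1) K1(2)[OF m] block_phi_nonneg[OF v m]
      by (intro mult_mono[OF mult_right_mono[OF mult_left_mono] tu]) auto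
    finally show "y * ln (2 + y) powr ?b
        \<le> ?c * K1 * K2 * 4 powr p * (1 + block_phi 0 v m) * (1 / m * (1 + (m * y) powr p))"
      by (simp add: t_def mult_ac)
  qed
qed

text \<open>Young's inequality without the sharp constants: the product is dominated by the first
  term when \<open>y\<close> is at most \<open>x powr (p - 1)\<close>, and by the second term
  otherwise.\<close>

lemma young_powr:
  fixes p x y :: real
  assumes "1 < p" "0 \<le> x" "0 \<le> y"
  shows "x * y \<le> x powr p + y powr (p / (p - 1))"
proof (cases "y \<le> x powr (p - 1)")
  case True
  then have "x * y \<le> x * x powr (p - 1)" using assms by (intro mult_left_mono)
  also have "\<dots> = x powr p" using assms by (cases "x = 0") (auto simp: powr_diff)
  finally show ?thesis by (simp add: add_increasing2)
next
  case False
  then have "(x powr (p - 1)) powr (1 / (p - 1)) \<le> y powr (1 / (p - 1))"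
    using assms by (intro powr_mono2) auto
  then have "x \<le> y powr (1 / (p - 1))" using assms by (cases "x = 0") (auto simp: powr_powr)
  then have "x * y \<le> y powr (1 / (p - 1)) * y" using assms by (intro mult_right_mono)
  also have "\<dots> = y powr (1 / (p - 1) + 1)" using assms by (simp add: powr_add)
  also have "1 / (p - 1) + 1 = p / (p - 1)" using assms by (simp add: field_simps)
  finally show ?thesis by (simp add: add_increasing)
qed

section \<open>Blocks\<close>

text \<open>Rewriting the norm condition as a bound on a finite power integral lets all later
  estimates treat finite and infinite \<open>q\<close> alike.\<close>

lemma q_block_powr_bound:
  fixes q :: ereal
  assumes q: "1 < q"
  obtains p where "p > 1"
    "\<And>X d (M :: 'a measure) B a. q_block X d M q B a \<Longrightarrow> B \<in> sets M \<Longrightarrow>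
       (\<integral>\<^sup>+x\<in>B. ennreal (cmod (a x) powr p) \<partial>M) \<le> ennreal (measure M B powr (1 - p))"
proof (cases q)
  case (real r)
  with q have r: "r > 1" by simp
  show thesis
  proof (rule that[OF r])
    fix X d and M :: "'a measure" and B a
    assume a: "q_block X d M q B a" "B \<in> sets M"
    define I where "I = (\<integral>\<^sup>+x\<in>B. ennreal (cmod (a x) powr r) \<partial>M)"
    have L: "Lq_norm_on q M B a \<le> ennreal (measure M B powr (- 1 / conj_exponent q))"
      using a(1) by (simp add: q_block_def)
    \<comment> \<open>\<open>Lq_norm_on\<close> is infinite when \<open>I\<close> is, so the finite
      bound excludes this case, in which \<open>enn2real I\<close> would be the default 0.\<close>
    then have fin: "I \<noteq> \<infinity>"
      using real by (auto simp: Lq_norm_on_def I_def[symmetric] Let_def top_unique split: if_splits)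
    \<comment> \<open>Here \<open>1 / conj_exponent q = (r - 1) / r\<close>, so raising to the power
      \<open>r\<close> produces the exponent \<open>1 - r\<close>.\<close>
    with L have "enn2real I powr (1 / r) \<le> measure M B powr (- (r - 1) / r)"
      using real r by (simp add: Lq_norm_on_def I_def[symmetric] conj_exponent_def)
    then have "(enn2real I powr (1 / r)) powr r \<le> (measure M B powr (- (r - 1) / r)) powr r"
      using r by (intro powr_mono2) auto
    then have "enn2real I \<le> measure M B powr (1 - r)"
      using r by (cases "enn2real I = 0") (auto simp: powr_powr)
    then have "ennreal (enn2real I) \<le> ennreal (measure M B powr (1 - r))"
      by (rule ennreal_leI)
    moreover have "ennreal (enn2real I) = I"
      using fin by (intro ennreal_enn2real) (simp add: less_top)
    ultimately show "(\<integral>\<^sup>+x\<in>B. ennreal (cmod (a x) powr r) \<partial>M) \<le> ennreal (measure M B powr (1 - r))"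
      by (simp add: I_def[symmetric])
  qed
next
  case PInf
  show thesis
  proof (rule that[of 2])
    fix X d and M :: "'a measure" and B a
    assume a: "q_block X d M q B a" "B \<in> sets M"
    have m: "measure M B > 0" using a(1) by (auto simp: q_block_def measure_def enn2real_positive_iff)
    have fin: "emeasure M B \<noteq> \<infinity>" using a(1) by (auto simp: q_block_def)
    have "esssup (restrict_space M B) (\<lambda>x. ennreal (cmod (a x))) \<le> ennreal (1 / measure M B)"
      using a(1) PInf m
      by (simp add: q_block_def Lq_norm_on_def conj_exponent_def powr_minus divide_inverse)
    then have "AE x in restrict_space M B. ennreal (cmod (a x)) \<le> ennreal (1 / measure M B)"
      using esssup_AE[of "\<lambda>x. ennreal (cmod (a x))" "restrict_space M B"] order_trans
      by (metis (mono_tags, lifting) eventually_mono)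
    moreover have "B \<inter> space M \<in> sets M" using a(2) by auto
    ultimately have "AE x in M. x \<in> B \<longrightarrow> ennreal (cmod (a x)) \<le> ennreal (1 / measure M B)"
      by (simp only: AE_restrict_space_iff)
    then have ae: "AE x in M. x \<in> B \<longrightarrow> cmod (a x) \<le> 1 / measure M B"
      using m by (simp add: ennreal_le_iff)
    have "(\<integral>\<^sup>+x\<in>B. ennreal (cmod (a x) powr 2) \<partial>M)
        \<le> (\<integral>\<^sup>+x. ennreal ((1 / measure M B) powr 2) * indicator B x \<partial>M)"
    proof (rule nn_integral_mono_AE, use ae in eventually_elim)
      case (elim x)
      show ?case
      proof (cases "x \<in> B")
        case True
        with elim have "cmod (a x) powr 2 \<le> (1 / measure M B) powr 2" by (intro powr_mono2) auto
        with True show ?thesis by (simp add: ennreal_leI)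
      qed simp
    qed
    also have "\<dots> = ennreal ((1 / measure M B) powr 2) * emeasure M B"
      using a(2) by (rule nn_integral_cmult_indicator)
    also have "\<dots> = ennreal ((1 / measure M B) powr 2 * measure M B)"
      using fin by (simp add: emeasure_eq_ennreal_measure ennreal_mult)
    also have "(1 / measure M B) powr 2 * measure M B = measure M B powr (1 - 2)"
      using m by (simp add: powr_divide powr_diff divide_simps power2_eq_square)
    finally show "(\<integral>\<^sup>+x\<in>B. ennreal (cmod (a x) powr 2) \<partial>M) \<le> ennreal (measure M B powr (1 - 2))" .
  qed simp
qed (use q in auto)

text \<open>For finite \<open>q\<close> take \<open>p = q\<close>; an \<open>\<infinity>\<close>-block satisfies the condition with \<open>p = 2\<close>.\<close>

definition power_block :: "real \<Rightarrow> 'a measure \<Rightarrow> 'a set \<Rightarrow> ('a \<Rightarrow> complex) \<Rightarrow> bool" where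
  "power_block p M B a \<longleftrightarrow>
     a \<in> borel_measurable M \<and> B \<in> sets M \<and> 0 < measure M B \<and> emeasure M B < \<infinity> \<and>
     (\<forall>x\<in>space M - B. a x = 0) \<and>
     (\<integral>\<^sup>+x\<in>B. ennreal (cmod (a x) powr p) \<partial>M) \<le> ennreal (measure M B powr (1 - p))"

lemma power_blockD:
  assumes "power_block p M B a"
  shows "a \<in> borel_measurable M" "B \<in> sets M" "0 < measure M B" "emeasure M B < \<infinity>"
    "\<forall>x\<in>space M - B. a x = 0"
    "(\<integral>\<^sup>+x\<in>B. ennreal (cmod (a x) powr p) \<partial>M) \<le> ennreal (measure M B powr (1 - p))"
  using assms by (simp_all add: power_block_def)

text \<open>The exponent \<open>p\<close> is fixed before the block, so one \<open>p\<close> serves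
  all blocks of a decomposition.\<close>

lemma q_block_power_block:
  fixes q :: ereal
  assumes q: "1 < q"
  obtains p where "p > 1"
    "\<And>X d (M :: 'a measure) B a. q_block X d M q B a \<Longrightarrow> space M = X \<Longrightarrow> B \<in> sets M \<Longrightarrow>
       power_block p M B a"
proof -
  obtain p where p: "p > 1"
    "\<And>X d (M :: 'a measure) B a. q_block X d M q B a \<Longrightarrow> B \<in> sets M \<Longrightarrow>
       (\<integral>\<^sup>+x\<in>B. ennreal (cmod (a x) powr p) \<partial>M) \<le> ennreal (measure M B powr (1 - p))"
    using q_block_powr_bound[OF q] by blast
  show thesis
  proof (rule that[OF p(1)])
    fix X d and M :: "'a measure" and B a
    assume a: "q_block X d M q B a" "space M = X" "B \<in> sets M"
    have "measure M B > 0" using a(1) by (auto simp: q_block_def measure_def enn2real_positive_iff)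
    then show "power_block p M B a"
      using a p(2)[OF a(1,3)] by (auto simp: power_block_def q_block_def)
  qed
qed

section \<open>Integral estimates for a single block\<close>

text \<open>The scale-free form of the block condition: multiplying by
  \<open>measure M B powr p\<close> cancels the exponent \<open>1 - p\<close> down to 1.\<close>

lemma nn_integral_scaled_powr_le:
  fixes a :: "'a \<Rightarrow> complex"
  assumes a: "a \<in> borel_measurable M" "B \<in> sets M" "0 < measure M B"
    and "(\<integral>\<^sup>+x\<in>B. ennreal (cmod (a x) powr p) \<partial>M) \<le> ennreal (measure M B powr (1 - p))"
  shows "(\<integral>\<^sup>+x\<in>B. ennreal ((measure M B * cmod (a x)) powr p) \<partial>M) \<le> ennreal (measure M B)"
proof -
  note [measurable] = a(1,2)
  let ?m = "measure M B"
  have "(\<integral>\<^sup>+x\<in>B. ennreal ((?m * cmod (a x)) powr p) \<partial>M)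
      = (\<integral>\<^sup>+x. ennreal (?m powr p) * (ennreal (cmod (a x) powr p) * indicator B x) \<partial>M)"
    by (intro nn_integral_cong) (simp add: powr_mult ennreal_mult mult.assoc)
  also have "\<dots> = ennreal (?m powr p) * (\<integral>\<^sup>+x\<in>B. ennreal (cmod (a x) powr p) \<partial>M)"
    using assms by (intro nn_integral_cmult) measurable
  also have "\<dots> \<le> ennreal (?m powr p) * ennreal (?m powr (1 - p))"
    using assms(4) by (rule mult_left_mono) simp
  also have "\<dots> = ennreal ?m"
    using assms(3) by (simp add: ennreal_mult[symmetric] powr_add[symmetric])
  finally show ?thesis .
qed

text \<open>Young's inequality for the scaled block and \<open>g\<close> takes the place of
  Hoelder's inequality. The factor \<open>measure M B\<close> stays on the left to avoid dividing in
  \<open>ennreal\<close>.\<close>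

lemma block_young_bound:
  fixes a :: "'a \<Rightarrow> complex"
  assumes blk: "power_block p M B a"
    and p: "1 < p" and g: "g \<in> borel_measurable M" "\<And>x. 0 \<le> g x"
  shows "ennreal (measure M B) * (\<integral>\<^sup>+x. ennreal (cmod (a x) * g x) \<partial>M)
      \<le> ennreal (measure M B) + (\<integral>\<^sup>+x\<in>B. ennreal (g x powr (p / (p - 1))) \<partial>M)"
proof -
  note a = power_blockD[OF blk]
  note [measurable] = a(1,2) g(1)
  let ?m = "measure M B"
  have "ennreal ?m * (\<integral>\<^sup>+x. ennreal (cmod (a x) * g x) \<partial>M)
      = (\<integral>\<^sup>+x. ennreal (?m * (cmod (a x) * g x)) \<partial>M)"
    using a g by (subst nn_integral_cmult[symmetric]) (auto simp: ennreal_mult)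
  also have "\<dots> \<le> (\<integral>\<^sup>+x. ennreal ((?m * cmod (a x)) powr p) * indicator B x
        + ennreal (g x powr (p / (p - 1))) * indicator B x \<partial>M)"
  proof (rule nn_integral_mono)
    fix x assume x: "x \<in> space M"
    show "ennreal (?m * (cmod (a x) * g x)) \<le> ennreal ((?m * cmod (a x)) powr p) * indicator B x
        + ennreal (g x powr (p / (p - 1))) * indicator B x"
    proof (cases "x \<in> B")
      case True
      then show ?thesis using young_powr[OF p, of "?m * cmod (a x)" "g x"] g(2)[of x]
        by (simp add: ennreal_plus[symmetric] mult.assoc del: ennreal_plus)
    qed (use x a in auto)
  qed
  also have "\<dots> = (\<integral>\<^sup>+x\<in>B. ennreal ((?m * cmod (a x)) powr p) \<partial>M)
      + (\<integral>\<^sup>+x\<in>B. ennreal (g x powr (p / (p - 1))) \<partial>M)"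
    using a g by (intro nn_integral_add) measurable
  also have "\<dots> \<le> ennreal ?m + (\<integral>\<^sup>+x\<in>B. ennreal (g x powr (p / (p - 1))) \<partial>M)"
    using nn_integral_scaled_powr_le[OF a(1,2,3,6)] by (rule add_right_mono)
  finally show ?thesis .
qed

lemma ennreal_mult_le_cancel:
  assumes "0 < m" "ennreal m * x \<le> ennreal (m * y)" "0 \<le> y"
  shows "x \<le> ennreal y"
proof -
  have "ennreal m * x \<le> ennreal m * ennreal y" using assms by (simp add: ennreal_mult)
  then show ?thesis using assms(1) by (subst (asm) ennreal_mult_le_mult_iff) auto
qed

text \<open>The case \<open>g = 1\<close> of \<open>block_young_bound\<close>. The constant is 2
  instead of the 1 of Hoelder's inequality, because \<open>young_powr\<close> has no sharp
  constants.\<close>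

lemma block_L1_bound:
  fixes a :: "'a \<Rightarrow> complex"
  assumes blk: "power_block p M B a"
    and p: "1 < p"
  shows "(\<integral>\<^sup>+x. ennreal (cmod (a x)) \<partial>M) \<le> 2"
proof -
  note a = power_blockD[OF blk]
  have e: "emeasure M B = ennreal (measure M B)"
    using a by (simp add: emeasure_eq_ennreal_measure)
  have "ennreal (measure M B) * (\<integral>\<^sup>+x. ennreal (cmod (a x) * 1) \<partial>M)
      \<le> ennreal (measure M B) + (\<integral>\<^sup>+x\<in>B. ennreal (1 powr (p / (p - 1))) \<partial>M)"
    by (intro block_young_bound assms) auto
  also have "\<dots> = ennreal (measure M B * 2)"
    using a by (simp add: e ennreal_plus[symmetric] mult_2_right del: ennreal_plus)
  finally show ?thesis using ennreal_mult_le_cancel[OF a(3), of _ 2] by simp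
qed

text \<open>The bound of \<open>LlogL_block_bound\<close> is integrated over \<open>B\<close>: the
  term 1 and the scaled power contribute at most \<open>measure M B\<close> each, which cancels
  \<open>1/m\<close> and leaves a factor 2.\<close>

lemma block_LlogL_bound:
  fixes p v :: real
  assumes p: "p > 1" and v: "v > -1"
  obtains K where "K > 0"
    "\<And>(M :: 'a measure) B a. power_block p M B a \<Longrightarrow>
      (\<integral>\<^sup>+x. ennreal (cmod (a x) * ln (2 + cmod (a x)) powr (1 + v)) \<partial>M)
        \<le> ennreal (K * (1 + block_phi 0 v (measure M B)))"
proof -
  obtain K where K: "K > 0" "\<And>m y. 0 < m \<Longrightarrow> 0 \<le> y \<Longrightarrow>
       y * ln (2 + y) powr (1 + v) \<le> K * (1 + block_phi 0 v m) * (1 / m * (1 + (m * y) powr p))"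
    using LlogL_block_bound[OF p v] by blast
  show thesis
  proof (rule that[of "2 * K"])
    fix M :: "'a measure" and B a
    assume "power_block p M B a"
    note a = power_blockD[OF this]
    note [measurable] = a(1,2)
    let ?m = "measure M B"
    define c where "c = K * (1 + block_phi 0 v ?m) * (1 / ?m)"
    have c: "c \<ge> 0" using K a block_phi_nonneg[OF v a(3)] by (simp add: c_def)
    have e: "emeasure M B = ennreal ?m" using a by (simp add: emeasure_eq_ennreal_measure)
    have "(\<integral>\<^sup>+x. ennreal (cmod (a x) * ln (2 + cmod (a x)) powr (1 + v)) \<partial>M)
        \<le> (\<integral>\<^sup>+x. ennreal c * (indicator B x + ennreal ((?m * cmod (a x)) powr p) * indicator B x) \<partial>M)"
    proof (rule nn_integral_mono)
      fix x assume x: "x \<in> space M"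
      show "ennreal (cmod (a x) * ln (2 + cmod (a x)) powr (1 + v))
        \<le> ennreal c * (indicator B x + ennreal ((?m * cmod (a x)) powr p) * indicator B x)"
      proof (cases "x \<in> B")
        case True
        have "cmod (a x) * ln (2 + cmod (a x)) powr (1 + v) \<le> c * (1 + (?m * cmod (a x)) powr p)"
          using K(2)[OF a(3), of "cmod (a x)"] by (simp add: c_def mult.assoc)
        then have "ennreal (cmod (a x) * ln (2 + cmod (a x)) powr (1 + v))
            \<le> ennreal (c * (1 + (?m * cmod (a x)) powr p))" by (rule ennreal_leI)
        also have "\<dots> = ennreal c * (1 + ennreal ((?m * cmod (a x)) powr p))"
          using c by (simp add: ennreal_mult)
        finally show ?thesis using True by simp
      qed (use x a in auto)
    qed
    also have "\<dots> = ennreal c * (emeasure M B + (\<integral>\<^sup>+x\<in>B. ennreal ((?m * cmod (a x)) powr p) \<partial>M))"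
      using a by (subst nn_integral_cmult) (auto simp: nn_integral_add)
    also have "\<dots> \<le> ennreal c * (ennreal ?m + ennreal ?m)"
      unfolding e using nn_integral_scaled_powr_le[OF a(1,2,3,6)] by (intro mult_left_mono add_left_mono) auto
    also have "\<dots> = ennreal (c * (?m + ?m))"
      using c by (simp only: ennreal_mult ennreal_plus measure_nonneg add_nonneg_nonneg)
    also have "c * (?m + ?m) = 2 * K * (1 + block_phi 0 v ?m)" using a(3) by (simp add: c_def)
    finally show "(\<integral>\<^sup>+x. ennreal (cmod (a x) * ln (2 + cmod (a x)) powr (1 + v)) \<partial>M)
        \<le> ennreal (2 * K * (1 + block_phi 0 v ?m))" .
  qed (use K in simp)
qed

section \<open>The inclusion\<close>

text \<open>Integrating \<open>(|f| - \<Sum>\<^sub>j |h\<^sub>j|)\<^sup>+ \<le> |f - \<Sum>\<^sub>j\<^sub><\<^sub>n h\<^sub>j|\<close> avoids passing to an a.e. convergent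
  subsequence.\<close>

lemma L1_limit_dominated:
  fixes f :: "'a \<Rightarrow> complex" and h :: "nat \<Rightarrow> 'a \<Rightarrow> complex"
  assumes f: "f \<in> borel_measurable M" and h: "\<And>j. h j \<in> borel_measurable M"
    and lim: "(\<lambda>n. \<integral>\<^sup>+x. ennreal (cmod (f x - (\<Sum>j<n. h j x))) \<partial>M) \<longlonglongrightarrow> 0"
  shows "AE x in M. ennreal (cmod (f x)) \<le> (\<Sum>j. ennreal (cmod (h j x)))"
proof -
  note [measurable] = f h
  let ?G = "\<lambda>x. \<Sum>j. ennreal (cmod (h j x))"
  have pt: "ennreal (cmod (f x)) - ?G x \<le> ennreal (cmod (f x - (\<Sum>j<n. h j x)))" for n x
  proof -
    have "cmod (f x) \<le> cmod (\<Sum>j<n. h j x) + cmod (f x - (\<Sum>j<n. h j x))"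
      using norm_triangle_ineq[of "\<Sum>j<n. h j x" "f x - (\<Sum>j<n. h j x)"] by simp
    also have "cmod (\<Sum>j<n. h j x) \<le> (\<Sum>j<n. cmod (h j x))" by (rule norm_sum)
    finally have "ennreal (cmod (f x))
        \<le> ennreal ((\<Sum>j<n. cmod (h j x)) + cmod (f x - (\<Sum>j<n. h j x)))"
      by (simp add: ennreal_leI)
    also have "\<dots> = (\<Sum>j<n. ennreal (cmod (h j x))) + ennreal (cmod (f x - (\<Sum>j<n. h j x)))"
      by (simp add: sum_nonneg)
    also have "\<dots> \<le> ?G x + ennreal (cmod (f x - (\<Sum>j<n. h j x)))"
      by (intro add_right_mono sum_le_suminf) auto
    finally show ?thesis by (simp add: ennreal_minus_le_iff)
  qed
  have "(\<integral>\<^sup>+x. ennreal (cmod (f x)) - ?G x \<partial>M) \<le> 0"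
    by (rule LIMSEQ_le_const[OF lim]) (use pt in \<open>auto intro!: nn_integral_mono\<close>)
  then have "AE x in M. ennreal (cmod (f x)) - ?G x = 0"
    by (subst nn_integral_0_iff_AE[symmetric]) (auto simp: le_zero_eq)
  then show ?thesis by eventually_elim (rule ennreal_minus_eq_0)
qed

text \<open>Only this almost everywhere domination is used of the convergence in \<open>L^1\<close>;
  afterwards all series are nonnegative and live in \<open>ennreal\<close>.\<close>

lemma block_space_dominated:
  fixes f :: "'a \<Rightarrow> complex"
  assumes f: "f \<in> block_space X d M q v"
  obtains l :: "nat \<Rightarrow> complex" and a B where
    "\<And>j. q_block X d M q (B j) (a j)"
    "summable (\<lambda>j. cmod (l j) * (1 + block_phi 0 v (measure M (B j))))"
    "AE x in M. ennreal (cmod (f x)) \<le> (\<Sum>j. ennreal (cmod (l j)) * ennreal (cmod (a j x)))"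
proof -
  obtain l :: "nat \<Rightarrow> complex" and a B where *: "\<And>j. q_block X d M q (B j) (a j)"
    "summable (\<lambda>j. cmod (l j) * (1 + block_phi 0 v (measure M (B j))))"
    "(\<lambda>n. \<integral>\<^sup>+x. ennreal (cmod (f x - (\<Sum>j<n. l j * a j x))) \<partial>M) \<longlonglongrightarrow> 0"
    and i: "integrable M f"
    using f unfolding block_space_def by blast
  have [measurable]: "a j \<in> borel_measurable M" for j
    using *(1) by (simp add: q_block_def)
  have "AE x in M. ennreal (cmod (f x)) \<le> (\<Sum>j. ennreal (cmod (l j * a j x)))"
    using i by (intro L1_limit_dominated *(3)) auto
  then have "AE x in M. ennreal (cmod (f x)) \<le> (\<Sum>j. ennreal (cmod (l j)) * ennreal (cmod (a j x)))"
    by (simp only: norm_mult ennreal_mult norm_ge_zero)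
  then show thesis by (rule that[OF *(1,2)])
qed

text \<open>A duality estimate: a weight that pairs well with every block pairs well with
  \<open>f\<close>. The number \<open>S\<close> is the sum of the weighted coefficients of one
  decomposition. It is obtained before \<open>w\<close> and \<open>K\<close>, so one
  \<open>S\<close> serves a whole sequence of weights.\<close>

lemma block_space_weighted_integral_le:
  fixes f :: "'a \<Rightarrow> complex"
  assumes v: "v > -1" and f: "f \<in> block_space X d M q v"
  obtains S where "S \<ge> 0"
    "\<forall>w\<in>borel_measurable M. \<forall>K\<ge>0.
       (\<forall>B a. q_block X d M q B a \<longrightarrow>
         (\<integral>\<^sup>+x. ennreal (cmod (a x)) * w x \<partial>M) \<le> ennreal (K * (1 + block_phi 0 v (measure M B)))) \<longrightarrow>
       (\<integral>\<^sup>+x. ennreal (cmod (f x)) * w x \<partial>M) \<le> ennreal (K * S)"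
proof -
  obtain l :: "nat \<Rightarrow> complex" and a B where *: "\<And>j. q_block X d M q (B j) (a j)"
    "summable (\<lambda>j. cmod (l j) * (1 + block_phi 0 v (measure M (B j))))"
    "AE x in M. ennreal (cmod (f x)) \<le> (\<Sum>j. ennreal (cmod (l j)) * ennreal (cmod (a j x)))"
    by (rule block_space_dominated[OF f], rule that)
  have [measurable]: "a j \<in> borel_measurable M" for j
    using *(1) by (simp add: q_block_def)
  have m: "measure M (B j) > 0" for j
    using *(1)[of j] by (auto simp: q_block_def measure_def enn2real_positive_iff)
  let ?s = "\<lambda>j. cmod (l j) * (1 + block_phi 0 v (measure M (B j)))"
  have s0: "0 \<le> ?s j" for j using block_phi_nonneg[OF v m[of j]] by simp
  show thesis
  proof (rule that[of "suminf ?s"]; (intro ballI allI impI)?)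
    show "0 \<le> suminf ?s" using *(2) s0 by (rule suminf_nonneg)
    fix w :: "'a \<Rightarrow> ennreal" and K :: real
    assume [measurable]: "w \<in> borel_measurable M" and K: "0 \<le> K"
      and w: "\<forall>B a. q_block X d M q B a \<longrightarrow>
         (\<integral>\<^sup>+x. ennreal (cmod (a x)) * w x \<partial>M) \<le> ennreal (K * (1 + block_phi 0 v (measure M B)))"
    have "(\<integral>\<^sup>+x. ennreal (cmod (f x)) * w x \<partial>M)
        \<le> (\<integral>\<^sup>+x. (\<Sum>j. ennreal (cmod (l j)) * ennreal (cmod (a j x))) * w x \<partial>M)"
      using *(3) by (intro nn_integral_mono_AE) (auto elim!: eventually_mono intro: mult_right_mono)
    also have "\<dots> = (\<integral>\<^sup>+x. (\<Sum>j. ennreal (cmod (l j)) * (ennreal (cmod (a j x)) * w x)) \<partial>M)"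
      by (simp add: ennreal_suminf_multc[symmetric] mult.assoc)
    also have "\<dots> = (\<Sum>j. ennreal (cmod (l j)) * (\<integral>\<^sup>+x. ennreal (cmod (a j x)) * w x \<partial>M))"
      by (subst nn_integral_suminf) (simp_all add: nn_integral_cmult)
    also have "\<dots> \<le> (\<Sum>j. ennreal (K * ?s j))"
    proof (intro suminf_le)
      fix j
      have "ennreal (cmod (l j)) * (\<integral>\<^sup>+x. ennreal (cmod (a j x)) * w x \<partial>M)
          \<le> ennreal (cmod (l j)) * ennreal (K * (1 + block_phi 0 v (measure M (B j))))"
        by (intro mult_left_mono w[rule_format] *) simp
      also have "\<dots> = ennreal (K * ?s j)"
        by (subst ennreal_mult'[symmetric]) (simp_all add: mult_ac)
      finally show "ennreal (cmod (l j)) * (\<integral>\<^sup>+x. ennreal (cmod (a j x)) * w x \<partial>M) \<le> \<dots>" .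
    qed auto
    also have "\<dots> = ennreal (K * suminf ?s)"
      using K s0 *(2) by (subst suminf_ennreal2) (auto simp: suminf_mult intro!: mult_nonneg_nonneg summable_mult)
    finally show "(\<integral>\<^sup>+x. ennreal (cmod (f x)) * w x \<partial>M) \<le> ennreal (K * suminf ?s)" .
  qed
qed

text \<open>The integrand is not subadditive in \<open>f\<close>, so the blocks cannot be summed
  directly. With \<open>F\<close> the dominating series, \<open>F * ln (2 + F) powr (1+v)\<close> is
  expanded only in its first factor. \<open>LlogL_mixed_bound\<close> then trades the logarithm of
  \<open>F\<close> for that of each block, at the cost of adding \<open>F\<close>, which is
  integrable; the coefficients never enter a logarithm.\<close>

lemma block_space_subset_LlogL:
  fixes M :: "'a measure"
  assumes v: "v > -1" and q: "1 < q" and X: "space M = X"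
    and balls: "\<And>x r. x \<in> X \<Longrightarrow> r > 0 \<Longrightarrow> qball X d x r \<in> sets M"
  shows "block_space X d M q v \<subseteq> LlogL_space M (1 + v)"
proof
  fix f assume f: "f \<in> block_space X d M q v"
  have [measurable]: "f \<in> borel_measurable M" using f by (auto simp: block_space_def)
  obtain p where p: "p > 1"
    "\<And>X d (M :: 'a measure) B a. q_block X d M q B a \<Longrightarrow> space M = X \<Longrightarrow> B \<in> sets M \<Longrightarrow>
       power_block p M B a"
    using q_block_power_block[OF q] by blast
  obtain l :: "nat \<Rightarrow> complex" and a B where *: "\<And>j. q_block X d M q (B j) (a j)"
    "summable (\<lambda>j. cmod (l j) * (1 + block_phi 0 v (measure M (B j))))"
    "AE x in M. ennreal (cmod (f x)) \<le> (\<Sum>j. ennreal (cmod (l j)) * ennreal (cmod (a j x)))"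
    by (rule block_space_dominated[OF f], rule that)
  have blk: "power_block p M (B j) (a j)" for j
  proof (rule p(2)[OF *(1) X])
    show "B j \<in> sets M" using *(1)[of j] balls by (auto simp: q_block_def)
  qed
  note [measurable] = power_blockD(1)[OF blk]
  let ?b = "1 + v"
  let ?s = "\<lambda>j. cmod (l j) * (1 + block_phi 0 v (measure M (B j)))"
  have phi0: "0 \<le> block_phi 0 v (measure M (B j))" for j
    using block_phi_nonneg[OF v power_blockD(3)[OF blk]] .
  then have s0: "0 \<le> ?s j" for j by simp
  have fin: "(\<Sum>j. ennreal (K * ?s j)) < \<infinity>" if "K \<ge> 0" for K
    using that s0 *(2) by (subst suminf_ennreal2) (auto intro!: mult_nonneg_nonneg summable_mult)
  define F where "F = (\<lambda>x. \<Sum>j. ennreal (cmod (l j)) * ennreal (cmod (a j x)))"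
  have [measurable]: "F \<in> borel_measurable M" unfolding F_def by measurable
  have "(\<integral>\<^sup>+x. F x \<partial>M) = (\<Sum>j. ennreal (cmod (l j)) * (\<integral>\<^sup>+x. ennreal (cmod (a j x)) \<partial>M))"
    unfolding F_def by (subst nn_integral_suminf) (simp_all add: nn_integral_cmult)
  also have "\<dots> \<le> (\<Sum>j. ennreal (2 * ?s j))"
  proof (intro suminf_le)
    fix j
    have "ennreal (cmod (l j)) * (\<integral>\<^sup>+x. ennreal (cmod (a j x)) \<partial>M) \<le> ennreal (cmod (l j)) * ennreal 2"
      using block_L1_bound[OF blk p(1)] by (intro mult_left_mono) auto
    also have "\<dots> = ennreal (2 * cmod (l j))"
      by (subst ennreal_mult'[symmetric]) (simp_all add: mult_ac)
    also have "\<dots> \<le> ennreal (2 * ?s j)"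
      using phi0[of j] by (intro ennreal_leI mult_left_mono) (auto simp: algebra_simps)
    finally show "ennreal (cmod (l j)) * (\<integral>\<^sup>+x. ennreal (cmod (a j x)) \<partial>M) \<le> \<dots>" .
  qed auto
  finally have Ffin: "(\<integral>\<^sup>+x. F x \<partial>M) < \<infinity>" using fin[of 2] by (simp add: order_le_less_trans)
  define T where "T = enn2real (\<integral>\<^sup>+x. F x \<partial>M)"
  have T: "T \<ge> 0" "(\<integral>\<^sup>+x. F x \<partial>M) = ennreal T" using Ffin by (auto simp: T_def)
  obtain K where K: "K > 0" "\<And>x y. 0 \<le> x \<Longrightarrow> 0 \<le> y \<Longrightarrow>
      x * ln (2 + y) powr ?b \<le> K * (x * ln (2 + x) powr ?b + y)"
    using LlogL_mixed_bound[of ?b] v by auto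
  obtain K' where K': "K' > 0" "\<And>(M :: 'a measure) B a. power_block p M B a \<Longrightarrow>
      (\<integral>\<^sup>+x. ennreal (cmod (a x) * ln (2 + cmod (a x)) powr ?b) \<partial>M)
        \<le> ennreal (K' * (1 + block_phi 0 v (measure M B)))"
    using block_LlogL_bound[OF p(1) v] by blast
  \<comment> \<open>Finiteness allows \<open>F x\<close> to be replaced by a real \<open>y\<close>,
    to which the real inequalities apply.\<close>
  have "AE x in M. F x < \<infinity>"
    using nn_integral_noteq_infinite[of F M] Ffin by (auto simp: less_top)
  then have "AE x in M. ennreal (cmod (f x) * ln (2 + cmod (f x)) powr ?b)
      \<le> (\<Sum>j. ennreal (cmod (l j)) * (ennreal K *
            (ennreal (cmod (a j x) * ln (2 + cmod (a j x)) powr ?b) + F x)))"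
    using *(3)
  proof eventually_elim
    case (elim x)
    define y where "y = enn2real (F x)"
    have y: "y \<ge> 0" "F x = ennreal y" using elim(1) by (auto simp: y_def)
    have "ennreal (cmod (f x)) \<le> F x" using elim(2) by (simp add: F_def)
    then have fy: "cmod (f x) \<le> y" using y by simp
    have "0 < 2 + cmod (f x)" by (simp add: add_pos_nonneg)
    then have "ln (2 + cmod (f x)) \<le> ln (2 + y)" using fy by (intro ln_mono) auto
    then have "ennreal (cmod (f x) * ln (2 + cmod (f x)) powr ?b) \<le> ennreal (y * ln (2 + y) powr ?b)"
      using fy y v by (intro ennreal_leI mult_mono powr_mono2) auto
    also have "\<dots> = F x * ennreal (ln (2 + y) powr ?b)" using y by (simp add: ennreal_mult)
    also have "\<dots> = (\<Sum>j. ennreal (cmod (l j)) * (ennreal (cmod (a j x) * ln (2 + y) powr ?b)))"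
      unfolding F_def by (simp add: ennreal_suminf_multc[symmetric] mult.assoc ennreal_mult)
    also have "\<dots> \<le> (\<Sum>j. ennreal (cmod (l j)) * (ennreal K *
            (ennreal (cmod (a j x) * ln (2 + cmod (a j x)) powr ?b) + F x)))"
    proof (intro suminf_le mult_left_mono)
      fix j
      have "ennreal (cmod (a j x) * ln (2 + y) powr ?b)
          \<le> ennreal (K * (cmod (a j x) * ln (2 + cmod (a j x)) powr ?b + y))"
        using K(2) y by (intro ennreal_leI) auto
      also have "\<dots> = ennreal K * (ennreal (cmod (a j x) * ln (2 + cmod (a j x)) powr ?b) + F x)"
        using K(1) y by (simp add: ennreal_mult)
      finally show "ennreal (cmod (a j x) * ln (2 + y) powr ?b) \<le> \<dots>" .
    qed auto
    finally show ?case .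
  qed
  then have "(\<integral>\<^sup>+x. ennreal (cmod (f x) * ln (2 + cmod (f x)) powr ?b) \<partial>M)
      \<le> (\<integral>\<^sup>+x. (\<Sum>j. ennreal (cmod (l j)) * (ennreal K *
            (ennreal (cmod (a j x) * ln (2 + cmod (a j x)) powr ?b) + F x))) \<partial>M)"
    by (rule nn_integral_mono_AE)
  also have "\<dots> = (\<Sum>j. ennreal (cmod (l j)) * (ennreal K *
      ((\<integral>\<^sup>+x. ennreal (cmod (a j x) * ln (2 + cmod (a j x)) powr ?b) \<partial>M) + (\<integral>\<^sup>+x. F x \<partial>M))))"
    by (subst nn_integral_suminf) (simp_all add: nn_integral_cmult nn_integral_add)
  also have "\<dots> \<le> (\<Sum>j. ennreal (K * (K' + T) * ?s j))"
  proof (intro suminf_le)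
    fix j
    let ?ph = "block_phi 0 v (measure M (B j))"
    have "ennreal (cmod (l j)) * (ennreal K *
      ((\<integral>\<^sup>+x. ennreal (cmod (a j x) * ln (2 + cmod (a j x)) powr ?b) \<partial>M) + (\<integral>\<^sup>+x. F x \<partial>M)))
      \<le> ennreal (cmod (l j)) * (ennreal K * (ennreal (K' * (1 + ?ph)) + ennreal T))"
      unfolding T(2) by (intro mult_left_mono add_right_mono K'(2) blk) auto
    also have "\<dots> = ennreal (cmod (l j) * (K * (K' * (1 + ?ph) + T)))"
      using K K' phi0[of j] T by (simp add: ennreal_mult)
    \<comment> \<open>The constant \<open>T\<close> is absorbed because \<open>1 + ?ph\<close> is at
      least 1.\<close>
    also have "\<dots> \<le> ennreal (cmod (l j) * (K * ((K' + T) * (1 + ?ph))))"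
      using K K' phi0[of j] T by (intro ennreal_leI mult_left_mono) (auto simp: algebra_simps)
    also have "cmod (l j) * (K * ((K' + T) * (1 + ?ph))) = K * (K' + T) * ?s j" by simp
    finally show "ennreal (cmod (l j)) * (ennreal K *
      ((\<integral>\<^sup>+x. ennreal (cmod (a j x) * ln (2 + cmod (a j x)) powr ?b) \<partial>M) + (\<integral>\<^sup>+x. F x \<partial>M))) \<le> \<dots>" .
  qed auto
  also have "\<dots> < \<infinity>" using K K' T by (intro fin) auto
  finally show "f \<in> LlogL_space M ?b" by (simp add: LlogL_space_def)
qed

section \<open>Dispersed sets\<close>

locale ahlfors_regular =
  fixes X :: "'a set" and d :: "'a \<Rightarrow> 'a \<Rightarrow> real" and M :: "'a measure" and s A c C :: real
  assumes const_pos: "0 < s" "1 \<le> A" "0 < c" "0 < C"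
    and d_sym: "x \<in> X \<Longrightarrow> y \<in> X \<Longrightarrow> d x y = d y x"
    and d_refl: "x \<in> X \<Longrightarrow> d x x = 0"
    and d_triangle: "x \<in> X \<Longrightarrow> y \<in> X \<Longrightarrow> z \<in> X \<Longrightarrow> d x y \<le> A * (d x z + d z y)"
    and space_eq: "space M = X"
    and ball_sets: "x \<in> X \<Longrightarrow> 0 < r \<Longrightarrow> qball X d x r \<in> sets M"
    and ball_lower: "x \<in> X \<Longrightarrow> 0 < r \<Longrightarrow> ennreal r < qdiam X d \<Longrightarrow>
      ennreal (c * r powr s) \<le> emeasure M (qball X d x r)"
    and ball_upper: "x \<in> X \<Longrightarrow> 0 < r \<Longrightarrow> ennreal r < qdiam X d \<Longrightarrow>
      emeasure M (qball X d x r) \<le> ennreal (C * r powr s)"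
begin

text \<open>The inequality is not strict, so it is exactly the negation of membership in an open
  ball of radius \<open>e\<close>; a maximal separated set therefore gives a cover by such
  balls.\<close>

definition separated :: "real \<Rightarrow> 'a set \<Rightarrow> bool" where
  "separated e S \<longleftrightarrow> S \<subseteq> X \<and> (\<forall>x\<in>S. \<forall>y\<in>S. x \<noteq> y \<longrightarrow> e \<le> d x y)"

lemma separated_subset:
  assumes S: "separated e S" and T: "T \<subseteq> S"
  shows "separated e T"
  unfolding separated_def
proof (intro conjI ballI impI)
  show "T \<subseteq> X" using S T by (auto simp: separated_def)
  fix x y assume "x \<in> T" "y \<in> T" "x \<noteq> y"
  then show "e \<le> d x y" using S T by (simp add: separated_def subset_iff)
qed

lemma separated_disjoint_balls:
  assumes S: "separated e S" and r: "2 * A * r \<le> e"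
  shows "disjoint_family_on (\<lambda>x. qball X d x r) S"
  unfolding disjoint_family_on_def
proof (intro ballI impI, rule ccontr)
  fix x y assume xy: "x \<in> S" "y \<in> S" "x \<noteq> y" and "qball X d x r \<inter> qball X d y r \<noteq> {}"
  then obtain z where z: "z \<in> X" "d x z < r" "d y z < r" by (auto simp: qball_def)
  have X: "x \<in> X" "y \<in> X" using xy S by (auto simp: separated_def)
  have "e \<le> d x y" using S xy by (auto simp: separated_def)
  also have "\<dots> \<le> A * (d x z + d z y)" using X z by (intro d_triangle)
  also have "\<dots> < A * (r + r)"
    using z X d_sym[of y z] const_pos by (intro mult_strict_left_mono add_strict_mono) auto
  finally show False using r by simp
qed

lemma emeasure_separated_balls:
  assumes S: "separated e S" "finite S" and r: "0 < r" "2 * A * r \<le> e"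
  shows "emeasure M (\<Union>x\<in>S. qball X d x r) = (\<Sum>x\<in>S. emeasure M (qball X d x r))"
  using S r separated_disjoint_balls[OF S(1) r(2)] ball_sets
  by (intro sum_emeasure[symmetric]) (auto simp: separated_def)

text \<open>Volume counting: the balls of radius \<open>e / (2 * A)\<close> about \<open>S\<close>
  are disjoint and lie in the ball of radius \<open>3 * A^2 * r\<close> about \<open>x\<close>.
  Comparing lower and upper regularity gives the bound, where \<open>6 * A^3\<close> is the ratio of
  these radii up to \<open>r / e\<close>.\<close>

lemma separated_card_le:
  assumes S: "separated e S" "finite S" and e: "0 < e" "e \<le> r"
    and x: "x \<in> X" "\<And>y. y \<in> S \<Longrightarrow> d x y \<le> 2 * A * r"
    and r: "ennreal (3 * A\<^sup>2 * r) < qdiam X d"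
  shows "real (card S) \<le> C / c * (6 * A ^ 3) powr s * (r / e) powr s"
proof -
  let ?t = "e / (2 * A)"
  have A: "1 \<le> A" "0 < A" using const_pos by auto
  have A2: "A \<le> A\<^sup>2" using A by (simp add: power2_eq_square)
  have t: "0 < ?t" using e A by simp
  have te: "?t \<le> e" using e A by (simp add: field_simps)
  have "e \<le> 3 * A\<^sup>2 * r"
  proof -
    have "1 \<le> 3 * A\<^sup>2" using A(1) A2 by linarith
    then have "1 * r \<le> 3 * A\<^sup>2 * r" using e by (intro mult_right_mono) auto
    then show ?thesis using e by linarith
  qed
  then have td: "ennreal ?t < qdiam X d"
    using te r by (intro le_less_trans[OF ennreal_leI r]) auto
  have R: "0 < 3 * A\<^sup>2 * r" using A e by simp
  have sub: "(\<Union>y\<in>S. qball X d y ?t) \<subseteq> qball X d x (3 * A\<^sup>2 * r)"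
  proof
    fix z assume "z \<in> (\<Union>y\<in>S. qball X d y ?t)"
    then obtain y where y: "y \<in> S" "z \<in> X" "d y z < ?t" by (auto simp: qball_def)
    then have "y \<in> X" using S by (auto simp: separated_def)
    have "d x z \<le> A * (d x y + d y z)" using y x \<open>y \<in> X\<close> by (intro d_triangle)
    also have "\<dots> < A * (2 * A * r + e)"
      using x(2)[OF y(1)] y(3) te A by (intro mult_strict_left_mono) auto
    also have "\<dots> \<le> A * (2 * A * r + A * r)"
    proof (intro mult_left_mono add_left_mono)
      have "1 * r \<le> A * r" using A e by (intro mult_right_mono) auto
      then show "e \<le> A * r" using e by linarith
    qed (use A in auto)
    also have "\<dots> = 3 * A\<^sup>2 * r" by (simp add: power2_eq_square algebra_simps)
    finally show "z \<in> qball X d x (3 * A\<^sup>2 * r)" using y by (simp add: qball_def)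
  qed
  have "ennreal (real (card S) * (c * ?t powr s)) = (\<Sum>y\<in>S. ennreal (c * ?t powr s))"
    using const_pos by (simp add: ennreal_mult ennreal_of_nat_eq_real_of_nat)
  also have "\<dots> \<le> (\<Sum>y\<in>S. emeasure M (qball X d y ?t))"
    using S(1) t td by (intro sum_mono ball_lower) (auto simp: separated_def)
  also have "\<dots> = emeasure M (\<Union>y\<in>S. qball X d y ?t)"
    using S t A by (intro emeasure_separated_balls[symmetric]) auto
  also have "\<dots> \<le> emeasure M (qball X d x (3 * A\<^sup>2 * r))"
    using sub x R by (intro emeasure_mono ball_sets)
  also have "\<dots> \<le> ennreal (C * (3 * A\<^sup>2 * r) powr s)"
    using x R r by (intro ball_upper)
  finally have "real (card S) * (c * ?t powr s) \<le> C * (3 * A\<^sup>2 * r) powr s"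
    using const_pos by (subst (asm) ennreal_le_iff) auto
  then have "real (card S) \<le> C * (3 * A\<^sup>2 * r) powr s / (c * ?t powr s)"
    using const_pos e A by (subst pos_le_divide_eq) simp_all
  also have "\<dots> = C / c * ((3 * A\<^sup>2 * r) / ?t) powr s"
    by (subst powr_divide) simp
  also have "(3 * A\<^sup>2 * r) / ?t = (6 * A ^ 3) * (r / e)"
    by (simp add: power2_eq_square power3_eq_cube)
  also have "C / c * (6 * A ^ 3 * (r / e)) powr s = C / c * (6 * A ^ 3) powr s * (r / e) powr s"
    by (subst powr_mult) simp
  finally show ?thesis .
qed

text \<open>The counting bound permits choosing \<open>S\<close> of maximal cardinality. A point
  left uncovered could be added to it.\<close>

lemma maximal_separated:
  assumes e: "0 < e" "e \<le> R" and x: "x \<in> X" and R: "ennreal (3 * A\<^sup>2 * R) < qdiam X d"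
  obtains S where "finite S" "separated e S" "S \<subseteq> qball X d x R"
    "qball X d x R \<subseteq> (\<Union>y\<in>S. qball X d y e)"
proof -
  let ?P = "\<lambda>S. finite S \<and> separated e S \<and> S \<subseteq> qball X d x R"
  obtain N :: nat where N: "C / c * (6 * A ^ 3) powr s * (R / e) powr s \<le> real N"
    using real_arch_simple by blast
  have le: "R \<le> 2 * A * R" using const_pos e by simp
  have "card S < Suc N" if "?P S" for S
  proof -
    have "d x y \<le> 2 * A * R" if "y \<in> S" for y
      using that \<open>?P S\<close> le by (force simp: qball_def)
    then have "real (card S) \<le> C / c * (6 * A ^ 3) powr s * (R / e) powr s"
      using that e x R by (intro separated_card_le) auto
    then show ?thesis using N by simp
  qed
  moreover have "?P {}" by (simp add: separated_def)
  ultimately obtain S where S: "?P S" and max: "\<And>T. ?P T \<Longrightarrow> card T \<le> card S"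
    using ex_has_greatest_nat[of ?P "{}" card "Suc N"] by blast
  have "qball X d x R \<subseteq> (\<Union>y\<in>S. qball X d y e)"
  proof (rule ccontr)
    assume "\<not> ?thesis"
    then obtain z where z: "z \<in> qball X d x R" "\<And>y. y \<in> S \<Longrightarrow> e \<le> d y z"
      by (force simp: qball_def)
    have zX: "z \<in> X" using z by (simp add: qball_def)
    have "z \<notin> S" using z(2)[of z] d_refl[OF zX] e by auto
    moreover have "separated e (insert z S)"
      unfolding separated_def
    proof (intro conjI ballI impI)
      show "insert z S \<subseteq> X" using S zX by (simp add: separated_def)
      fix y y' assume y: "y \<in> insert z S" "y' \<in> insert z S" "y \<noteq> y'"
      have "d z w = d w z" if "w \<in> S" for w
        using that S zX by (intro d_sym) (auto simp: separated_def)
      then show "e \<le> d y y'" using y z(2) S by (auto simp: separated_def)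
    qed
    then have "?P (insert z S)" using S z(1) by simp
    ultimately show False using max[of "insert z S"] S by simp
  qed
  with S that show thesis by blast
qed

text \<open>Shrinking balls of radius \<open>e\<close> by the factor \<open>t powr (1/s)\<close>
  leaves about the fraction \<open>t\<close> of their measure. Both \<open>m\<close> and
  \<open>K\<close> are independent of \<open>t\<close> and \<open>e\<close>, so \<open>e\<close> can
  later be made small for fixed \<open>t\<close> at no cost.\<close>

lemma dispersed_set:
  assumes x0: "x0 \<in> X" and R: "0 < R" "ennreal (3 * A\<^sup>2 * R) < qdiam X d"
  obtains m K where "0 < m" "1 \<le> K"
    "\<And>t e. 0 < t \<Longrightarrow> t \<le> (1 / (2 * A)) powr s \<Longrightarrow> 0 < e \<Longrightarrow> e \<le> R \<Longrightarrow>
      \<exists>E\<in>sets M. ennreal (m * t) \<le> emeasure M E \<and> emeasure M E \<le> ennreal (K * t) \<and>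
        (\<forall>x\<in>X. \<forall>r\<ge>e. emeasure M (E \<inter> qball X d x r) \<le> ennreal (K * t) * emeasure M (qball X d x r))"
proof -
  have A: "1 \<le> A" "0 < A" using const_pos by auto
  define L where "L = C / c * (6 * A ^ 3) powr s * C"
  have L: "L > 0" using const_pos A by (simp add: L_def)
  \<comment> \<open>Covering the ball of radius \<open>R\<close> requires at least
    \<open>c * R powr s / (C * e powr s)\<close> centres, and each small ball has measure at least
    \<open>c * t * e powr s\<close>.\<close>
  define m where "m = c / C * R powr s * c"
  \<comment> \<open>The second entry bounds the total measure of the set, the third its density in
    balls.\<close>
  define K where "K = max 1 (max (L * R powr s) (L / c))"
  have K: "1 \<le> K" "L * R powr s \<le> K" "L / c \<le> K" by (auto simp: K_def)
  show thesis
  proof (rule that)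
    show "0 < m" using const_pos R by (simp add: m_def)
    show "1 \<le> K" by fact
    fix t e assume t: "0 < t" "t \<le> (1 / (2 * A)) powr s" and e: "0 < e" "e \<le> R"
    define \<delta> where "\<delta> = t powr (1 / s)"
    have \<delta>: "0 < \<delta>" using t by (simp add: \<delta>_def)
    have \<delta>t: "\<delta> powr s = t" using t const_pos by (simp add: \<delta>_def powr_powr)
    have "\<delta> \<le> ((1 / (2 * A)) powr s) powr (1 / s)"
      unfolding \<delta>_def using t const_pos by (intro powr_mono2) auto
    also have "\<dots> = 1 / (2 * A)" using A const_pos by (simp add: powr_powr)
    \<comment> \<open>The upper limit on \<open>t\<close> gives precisely what makes the balls of
      radius \<open>\<delta> * e\<close> about \<open>e\<close>-separated centres disjoint.\<close>
    finally have \<delta>A: "2 * A * \<delta> \<le> 1" using A by (simp add: field_simps)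
    have "1 * \<delta> \<le> 2 * A * \<delta>" using A \<delta> by (intro mult_right_mono) auto
    then have \<delta>1: "\<delta> \<le> 1" using \<delta>A by linarith
    have de: "0 < \<delta> * e" "\<delta> * e \<le> e" using \<delta> \<delta>1 e by auto
    then have deR: "\<delta> * e \<le> R" using e by linarith
    have RR: "R \<le> 3 * A\<^sup>2 * R"
    proof -
      have "1 \<le> 3 * A\<^sup>2" using one_le_power[OF A(1), of 2] by linarith
      then have "1 * R \<le> 3 * A\<^sup>2 * R" using R by (intro mult_right_mono) auto
      then show ?thesis by simp
    qed
    have diam: "ennreal r < qdiam X d" if "r \<le> R" for r
      using that RR by (intro le_less_trans[OF ennreal_leI R(2)]) auto
    obtain S where S: "finite S" "separated e S" "S \<subseteq> qball X d x0 R"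
      "qball X d x0 R \<subseteq> (\<Union>y\<in>S. qball X d y e)"
      using maximal_separated[OF e x0 R(2)] by blast
    have SX: "S \<subseteq> X" using S(2) by (simp add: separated_def)
    let ?b = "\<lambda>y. qball X d y (\<delta> * e)"
    define E where "E = (\<Union>y\<in>S. ?b y)"
    have bs: "?b y \<in> sets M" if "y \<in> S" for y using that SX de by (intro ball_sets) auto
    have E: "E \<in> sets M" unfolding E_def using bs S(1) by auto
    have bu: "emeasure M (?b y) \<le> ennreal (C * (\<delta> * e) powr s)" if "y \<in> S" for y
      using that SX de by (intro ball_upper diam deR) auto
    \<comment> \<open>Stated for subsets of \<open>S\<close> to serve twice: for the centres near a
      given ball, and for all of \<open>S\<close> with \<open>r = R\<close>.\<close>
    have upper: "emeasure M (\<Union>y\<in>T. ?b y) \<le> ennreal (L * t * r powr s)"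
      if T: "T \<subseteq> S" "\<And>y. y \<in> T \<Longrightarrow> d x y \<le> 2 * A * r" and x: "x \<in> X" and r: "e \<le> r" "r \<le> R" for T x r
    proof -
      have finT: "finite T" using T S by (auto intro: finite_subset)
      have "3 * A\<^sup>2 * r \<le> 3 * A\<^sup>2 * R" using r by (intro mult_left_mono) auto
      then have rd: "ennreal (3 * A\<^sup>2 * r) < qdiam X d" by (intro le_less_trans[OF ennreal_leI R(2)])
      have sepT: "separated e T" using S(2) T(1) by (rule separated_subset)
      have "emeasure M (\<Union>y\<in>T. ?b y) \<le> (\<Sum>y\<in>T. emeasure M (?b y))"
        using finT T(1) bs by (intro emeasure_subadditive_finite) blast+
      also have "\<dots> \<le> (\<Sum>y\<in>T. ennreal (C * (\<delta> * e) powr s))"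
        using T(1) bu by (intro sum_mono) blast
      also have "\<dots> = ennreal (real (card T) * (C * (\<delta> * e) powr s))"
        using const_pos by (simp add: ennreal_mult ennreal_of_nat_eq_real_of_nat)
      also have "\<dots> \<le> ennreal (C / c * (6 * A ^ 3) powr s * (r / e) powr s * (C * (\<delta> * e) powr s))"
        using const_pos by (intro ennreal_leI mult_right_mono
          separated_card_le[OF sepT finT e(1) r(1) x T(2) rd]) auto
      also have "C / c * (6 * A ^ 3) powr s * (r / e) powr s * (C * (\<delta> * e) powr s)
          = L * ((r / e) powr s * (\<delta> * e) powr s)" by (simp add: L_def)
      also have "(r / e) powr s * (\<delta> * e) powr s = t * r powr s"
        using \<delta> e r by (simp add: powr_mult powr_divide \<delta>t)
      finally show ?thesis by (simp add: mult.assoc)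
    qed
    have lower: "ennreal (m * t) \<le> emeasure M E"
    proof -
      have "ennreal (c * R powr s) \<le> emeasure M (qball X d x0 R)"
        using x0 R by (intro ball_lower diam) auto
      also have "\<dots> \<le> emeasure M (\<Union>y\<in>S. qball X d y e)"
        using S SX e by (intro emeasure_mono) (auto intro!: ball_sets)
      also have "\<dots> \<le> (\<Sum>y\<in>S. emeasure M (qball X d y e))"
        using S SX e by (intro emeasure_subadditive_finite) (auto intro!: ball_sets)
      also have "\<dots> \<le> (\<Sum>y\<in>S. ennreal (C * e powr s))"
        using SX e by (intro sum_mono ball_upper diam) auto
      also have "\<dots> = ennreal (real (card S) * (C * e powr s))"
        using const_pos by (simp add: ennreal_mult ennreal_of_nat_eq_real_of_nat)
      finally have "c * R powr s \<le> real (card S) * (C * e powr s)"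
        using const_pos by (subst (asm) ennreal_le_iff) auto
      then have "c * R powr s / (C * e powr s) \<le> real (card S)"
        using const_pos e by (subst pos_divide_le_eq) auto
      then have "c * R powr s / (C * e powr s) * (c * (\<delta> * e) powr s) \<le> real (card S) * (c * (\<delta> * e) powr s)"
        using const_pos by (intro mult_right_mono) auto
      also have "c * R powr s / (C * e powr s) * (c * (\<delta> * e) powr s) = m * t"
        using \<delta> e const_pos by (simp add: m_def powr_mult \<delta>t)
      finally have "ennreal (m * t) \<le> ennreal (real (card S) * (c * (\<delta> * e) powr s))" by (rule ennreal_leI)
      also have "\<dots> = (\<Sum>y\<in>S. ennreal (c * (\<delta> * e) powr s))"
        using const_pos by (simp add: ennreal_mult ennreal_of_nat_eq_real_of_nat)
      also have "\<dots> \<le> (\<Sum>y\<in>S. emeasure M (?b y))"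
        using SX de by (intro sum_mono ball_lower diam deR) auto
      also have "\<dots> = emeasure M E"
        unfolding E_def using S de e \<delta>A mult_right_mono[OF \<delta>A, of e]
        by (intro emeasure_separated_balls[symmetric]) (auto simp: mult_ac)
      finally show ?thesis .
    qed
    have "R \<le> 2 * A * R" using A R by simp
    then have "d x0 y \<le> 2 * A * R" if "y \<in> S" for y
      using S(3) that by (force simp: qball_def)
    then have total: "emeasure M E \<le> ennreal (L * t * R powr s)"
      unfolding E_def using x0 e by (intro upper order_refl)
    have "emeasure M (E \<inter> qball X d x r) \<le> ennreal (K * t) * emeasure M (qball X d x r)"
      if x: "x \<in> X" and r: "e \<le> r" for x r
    proof -
      define r' where "r' = min r R"
      have r': "e \<le> r'" "r' \<le> R" "r' \<le> r" "0 < r'" using r e by (auto simp: r'_def)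
      have "emeasure M (E \<inter> qball X d x r) \<le> ennreal (L * t * r' powr s)"
      proof (cases "r \<le> R")
        case True
        \<comment> \<open>Centres whose small ball meets the given ball are within
          \<open>2 * A * r\<close> of \<open>x\<close>, since \<open>\<delta> * e\<close> is at most
          \<open>r\<close>.\<close>
        define T where "T = {y \<in> S. ?b y \<inter> qball X d x r \<noteq> {}}"
        have "d x y \<le> 2 * A * r" if "y \<in> T" for y
        proof -
          obtain z where z: "z \<in> X" "d y z < \<delta> * e" "d x z < r" "y \<in> X"
            using \<open>y \<in> T\<close> SX by (auto simp: T_def qball_def)
          have "d x y \<le> A * (d x z + d z y)" using x z by (intro d_triangle)
          also have "\<dots> \<le> A * (r + r)"
            using z A d_sym[of y z] de r by (intro mult_left_mono add_mono) auto
          finally show ?thesis by simp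
        qed
        then have "emeasure M (\<Union>y\<in>T. ?b y) \<le> ennreal (L * t * r powr s)"
          using x r True by (intro upper[of T x r]) (auto simp: T_def)
        moreover have "emeasure M (E \<inter> qball X d x r) \<le> emeasure M (\<Union>y\<in>T. ?b y)"
          using S(1) bs by (intro emeasure_mono) (auto simp: E_def T_def)
        moreover have "r' = r" using True by (simp add: r'_def)
        ultimately show ?thesis by simp
      next
        case False
        then have "r' = R" by (simp add: r'_def)
        with total show ?thesis using emeasure_mono[OF Int_lower1 E, of "qball X d x r"]
          by (auto intro: order_trans)
      qed
      also have "\<dots> = ennreal (L / c * t) * ennreal (c * r' powr s)"
        using const_pos L t by (simp add: ennreal_mult[symmetric])
      also have "\<dots> \<le> ennreal (K * t) * emeasure M (qball X d x r')"
        using K t x r' by (intro mult_mono ennreal_leI mult_right_mono ball_lower diam) auto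
      also have "\<dots> \<le> ennreal (K * t) * emeasure M (qball X d x r)"
        using r' r e x by (intro mult_left_mono emeasure_mono ball_sets) (auto simp: qball_def)
      finally show ?thesis .
    qed
    moreover have "emeasure M E \<le> ennreal (K * t)"
    proof -
      have "L * R powr s * t \<le> K * t" using K t by (intro mult_right_mono) auto
      then show ?thesis using total by (intro order_trans[OF total] ennreal_leI) (simp add: mult_ac)
    qed
    ultimately show "\<exists>E\<in>sets M. ennreal (m * t) \<le> emeasure M E \<and> emeasure M E \<le> ennreal (K * t) \<and>
        (\<forall>x\<in>X. \<forall>r\<ge>e. emeasure M (E \<inter> qball X d x r) \<le> ennreal (K * t) * emeasure M (qball X d x r))"
      using E lower by blast
  qed
qed

end

section \<open>A function outside the block space\<close>

text \<open>\<open>block_phi 0 v\<close> blows up at 0. The maximum with 1 keeps \<open>z\<close>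
  positive, so that \<open>exp (- z)\<close> is below 1 and the closed form applies.\<close>

lemma block_phi_large:
  fixes v w :: real
  assumes v: "v > -1"
  obtains t0 where "0 < t0" "\<And>t. 0 < t \<Longrightarrow> t \<le> t0 \<Longrightarrow> w \<le> block_phi 0 v t"
proof -
  let ?b = "1 + v"
  have b: "?b > 0" using v by simp
  define z where "z = (?b * max w 1) powr (1 / ?b)"
  have z: "z > 0" using b by (simp add: z_def)
  show thesis
  proof (rule that[of "exp (- z)"])
    fix t :: real assume t: "0 < t" "t \<le> exp (- z)"
    have t1: "t < 1" using t z by (smt (verit) exp_less_one_iff)
    have "ln t \<le> - z" using t by (metis ln_exp ln_le_cancel_iff exp_gt_zero)
    then have l: "z \<le> ln (1 / t)" using t by (simp add: ln_div)
    have "?b * w \<le> ?b * max w 1" using b by (intro mult_left_mono) auto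
    also have "\<dots> = z powr ?b" using b by (simp add: z_def powr_powr)
    also have "\<dots> \<le> ln (1 / t) powr ?b" using l z b by (intro powr_mono2) auto
    finally have "w \<le> ln (1 / t) powr ?b / ?b" using b by (simp add: field_simps)
    also have "\<dots> = block_phi 0 v t" using v t t1 l z by (simp add: block_phi_0 log_plus_def)
    finally show "w \<le> block_phi 0 v t" .
  qed simp
qed

lemma powr_over_ln_powr_large:
  fixes a b y z :: real
  assumes "0 < a" "0 < b"
  obtains u where "z \<le> u" "y \<le> u powr a / ln (2 + u) powr b"
proof -
  have "filterlim (\<lambda>u::real. u powr a / ln (2 + u) powr b) at_top at_top"
    using assms by real_asymp
  then have "eventually (\<lambda>u. y \<le> u powr a / ln (2 + u) powr b) at_top"
    by (simp add: filterlim_at_top)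
  then have "eventually (\<lambda>u. y \<le> u powr a / ln (2 + u) powr b \<and> z \<le> u) at_top"
    by (intro eventually_conj eventually_ge_at_top)
  then show thesis using that by (auto simp: eventually_at_top_linorder)
qed

context ahlfors_regular
begin

text \<open>The weight \<open>w\<close> on \<open>E\<close> acts as a dual functional. It is bounded
  on blocks by \<open>K\<close>, which is meant not to depend on \<open>N\<close>, yet it takes a
  value at least \<open>N\<close> on the function of height \<open>\<alpha>\<close> on
  \<open>E\<close>, whose Orlicz integral is at most \<open>1 / N\<close>.\<close>

definition hump :: "real \<Rightarrow> real \<Rightarrow> real \<Rightarrow> real \<Rightarrow> 'a set \<Rightarrow> real \<Rightarrow> real \<Rightarrow> bool" where
  "hump p v K N E \<alpha> w \<longleftrightarrow> E \<in> sets M \<and> 0 < \<alpha> \<and> 0 < w \<and>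
      ennreal (\<alpha> * ln (2 + \<alpha>) powr (1 + v)) * emeasure M E \<le> ennreal (1 / N) \<and>
      ennreal N \<le> ennreal (\<alpha> * w) * emeasure M E \<and>
      (\<forall>B a x r. power_block p M B a \<longrightarrow> x \<in> X \<longrightarrow> 0 < r \<longrightarrow> B = qball X d x r \<longrightarrow>
        (\<integral>\<^sup>+y. ennreal (cmod (a y)) * ennreal (w * indicator E y) \<partial>M)
          \<le> ennreal (K * (1 + block_phi 0 v (measure M B))))"

text \<open>Order of choice: \<open>u\<close> large in terms of \<open>N\<close>, then
  \<open>w\<close> and \<open>\<alpha>\<close> from \<open>u\<close>, then \<open>e\<close> small in
  terms of \<open>w\<close>, and finally \<open>E\<close> from \<open>dispersed_set\<close> with
  \<open>t = 1 / u\<close>.\<close>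

lemma dispersed_hump:
  fixes p v :: real
  assumes p: "1 < p" and v: "v > -1"
    and x0: "x0 \<in> X" and R: "0 < R" "ennreal (3 * A\<^sup>2 * R) < qdiam X d"
  obtains K where "K > 0"
    "\<And>N. 1 \<le> N \<Longrightarrow> \<exists>E \<alpha> w. hump p v K N E \<alpha> w"
proof -
  obtain m K where mK: "0 < m" "1 \<le> K"
    and disp: "\<And>t e. 0 < t \<Longrightarrow> t \<le> (1 / (2 * A)) powr s \<Longrightarrow> 0 < e \<Longrightarrow> e \<le> R \<Longrightarrow>
      \<exists>E\<in>sets M. ennreal (m * t) \<le> emeasure M E \<and> emeasure M E \<le> ennreal (K * t) \<and>
        (\<forall>x\<in>X. \<forall>r\<ge>e. emeasure M (E \<inter> qball X d x r) \<le> ennreal (K * t) * emeasure M (qball X d x r))"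
    by (rule dispersed_set[OF x0 R], rule that)
  let ?b = "1 + v" and ?p = "p / (p - 1)"
  have b: "?b > 0" using v by simp
  have p': "?p > 0" using p by simp
  have A: "1 \<le> A" using const_pos by simp
  show thesis
  proof (rule that[of "2 + K"])
    fix N :: real assume N: "1 \<le> N"
    \<comment> \<open>The first bound makes \<open>1 / u\<close> admissible for
      \<open>dispersed_set\<close>; the second is exactly what the lower bound \<open>N\<close> on
      the pairing requires.\<close>
    obtain u where u0: "max 1 (1 / (1 / (2 * A)) powr s) \<le> u"
      and uN: "N\<^sup>2 * K / m \<le> u powr (1 / ?p) / ln (2 + u) powr ?b"
      using powr_over_ln_powr_large[of "1 / ?p" ?b] p' b by (metis zero_less_divide_1_iff)
    have u: "1 \<le> u" "1 / u \<le> (1 / (2 * A)) powr s"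
      using u0 A by (auto simp: field_simps)
    define w where "w = u powr (1 / ?p)"
    have w: "w > 0" "w powr ?p = u" using u p p' by (auto simp: w_def powr_powr)
    define L where "L = ln (2 + u) powr ?b"
    have L: "1 \<le> L"
    proof -
      have "1 \<le> ln (3::real)" using exp_le by (subst ln_ge_iff) auto
      also have "\<dots> \<le> ln (2 + u)" using u by (intro ln_mono) auto
      finally show ?thesis unfolding L_def using b by (intro ge_one_powr_ge_zero) auto
    qed
    \<comment> \<open>Chosen so that \<open>\<alpha> * L * (K / u) = 1 / N\<close>. As
      \<open>N * K * L\<close> is at least 1, \<open>\<alpha>\<close> is at most \<open>u\<close>,
      and \<open>L\<close> bounds its logarithmic factor.\<close>
    define \<alpha> where "\<alpha> = u / (N * K * L)"
    have NK: "1 \<le> N * K" using N mK mult_mono[of 1 N 1 K] by simp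
    then have NKL: "1 \<le> N * K * L" using L mult_mono[of 1 "N * K" 1 L] by simp
    have \<alpha>: "0 < \<alpha>" "\<alpha> \<le> u"
      using u NKL by (auto simp: \<alpha>_def divide_simps)
    obtain t0 where t0: "0 < t0" "\<And>t. 0 < t \<Longrightarrow> t \<le> t0 \<Longrightarrow> w \<le> block_phi 0 v t"
      using block_phi_large[OF v] by metis
    \<comment> \<open>Balls of radius below \<open>e\<close> then have measure at most
      \<open>t0\<close>, hence \<open>block_phi\<close> at least \<open>w\<close>.\<close>
    define e where "e = min R ((t0 / C) powr (1 / s))"
    have e: "0 < e" "e \<le> R" using R t0 const_pos by (auto simp: e_def)
    have Ce: "C * e powr s \<le> t0"
    proof -
      have "e powr s \<le> ((t0 / C) powr (1 / s)) powr s"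
        using e const_pos by (intro powr_mono2) (auto simp: e_def)
      also have "\<dots> = t0 / C" using const_pos t0 by (simp add: powr_powr)
      finally show ?thesis using const_pos by (simp add: field_simps)
    qed
    obtain E where E: "E \<in> sets M" "ennreal (m * (1 / u)) \<le> emeasure M E"
        "emeasure M E \<le> ennreal (K * (1 / u))"
        "\<And>x r. x \<in> X \<Longrightarrow> e \<le> r \<Longrightarrow>
          emeasure M (E \<inter> qball X d x r) \<le> ennreal (K * (1 / u)) * emeasure M (qball X d x r)"
      using disp[OF _ u(2) e] u(1) by auto
    note [measurable] = E(1)
    have LlogL: "ennreal (\<alpha> * ln (2 + \<alpha>) powr ?b) * emeasure M E \<le> ennreal (1 / N)"
    proof -
      have "ln (2 + \<alpha>) powr ?b \<le> L"
        unfolding L_def using \<alpha> b by (intro powr_mono2 ln_mono) auto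
      then have "ennreal (\<alpha> * ln (2 + \<alpha>) powr ?b) * emeasure M E
          \<le> ennreal (\<alpha> * L) * ennreal (K * (1 / u))"
        using \<alpha> E(3) by (intro mult_mono ennreal_leI mult_left_mono) auto
      also have "\<dots> = ennreal (\<alpha> * L * (K * (1 / u)))"
        using \<alpha> L mK u by (subst ennreal_mult) auto
      also have "\<alpha> * L * (K * (1 / u)) = 1 / N"
        using u mK L N by (simp add: \<alpha>_def)
      finally show ?thesis .
    qed
    have large: "ennreal N \<le> ennreal (\<alpha> * w) * emeasure M E"
    proof -
      have "N\<^sup>2 * K / m * (m / (N * K)) \<le> w / L * (m / (N * K))"
        using uN mK N by (intro mult_right_mono) (auto simp: w_def L_def)
      also have "N\<^sup>2 * K / m * (m / (N * K)) = N"
        using mK N by (simp add: power2_eq_square)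
      also have "w / L * (m / (N * K)) = \<alpha> * w * (m * (1 / u))"
        using u by (simp add: \<alpha>_def)
      finally have "ennreal N \<le> ennreal (\<alpha> * w * (m * (1 / u)))" by (rule ennreal_leI)
      also have "\<dots> = ennreal (\<alpha> * w) * ennreal (m * (1 / u))"
        using \<alpha> w mK u by (subst ennreal_mult) auto
      also have "\<dots> \<le> ennreal (\<alpha> * w) * emeasure M E" by (intro mult_left_mono E) auto
      finally show ?thesis .
    qed
    have "(\<integral>\<^sup>+y. ennreal (cmod (a y)) * ennreal (w * indicator E y) \<partial>M)
          \<le> ennreal ((2 + K) * (1 + block_phi 0 v (measure M B)))"
      if blk: "power_block p M B a" and x: "x \<in> X" "0 < r" and B: "B = qball X d x r" for B a x r
    proof -
      note a = power_blockD[OF blk]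
      note [measurable] = a(1,2)
      let ?m = "measure M B"
      have em: "emeasure M B = ennreal ?m" using a by (simp add: emeasure_eq_ennreal_measure)
      have phi: "0 \<le> block_phi 0 v ?m" by (rule block_phi_nonneg[OF v a(3)])
      show ?thesis
      proof (cases "e \<le> r")
        case True
        \<comment> \<open>The conjugate power of \<open>w\<close> equals \<open>u\<close>, which
          cancels the density \<open>K / u\<close> of \<open>E\<close> in the ball.\<close>
        have "(\<integral>\<^sup>+y\<in>B. ennreal ((w * indicator E y) powr ?p) \<partial>M)
            = (\<integral>\<^sup>+y. ennreal u * indicator (E \<inter> B) y \<partial>M)"
          using w by (intro nn_integral_cong) (auto split: split_indicator)
        also have "\<dots> = ennreal u * emeasure M (E \<inter> B)" by (intro nn_integral_cmult_indicator) measurable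
        also have "\<dots> \<le> ennreal u * (ennreal (K * (1 / u)) * emeasure M B)"
          unfolding B using x True by (intro mult_left_mono E) auto
        also have "\<dots> = ennreal (u * (K * (1 / u) * ?m))"
          unfolding em using u mK by (simp only: ennreal_mult mult_nonneg_nonneg measure_nonneg
              divide_nonneg_nonneg zero_le_one order_trans[OF zero_le_one])
        also have "u * (K * (1 / u) * ?m) = ?m * K" using u by simp
        finally have g: "(\<integral>\<^sup>+y\<in>B. ennreal ((w * indicator E y) powr ?p) \<partial>M) \<le> ennreal (?m * K)" .
        have "ennreal ?m * (\<integral>\<^sup>+y. ennreal (cmod (a y) * (w * indicator E y)) \<partial>M)
            \<le> ennreal ?m + (\<integral>\<^sup>+y\<in>B. ennreal ((w * indicator E y) powr ?p) \<partial>M)"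
          using w by (intro block_young_bound[OF blk p]) auto
        also have "\<dots> \<le> ennreal ?m + ennreal (?m * K)" using g by (rule add_left_mono)
        also have "\<dots> = ennreal (?m * (1 + K))"
          using mK by (simp add: ennreal_plus[symmetric] distrib_left del: ennreal_plus)
        finally have "(\<integral>\<^sup>+y. ennreal (cmod (a y) * (w * indicator E y)) \<partial>M) \<le> ennreal (1 + K)"
          by (rule ennreal_mult_le_cancel[OF a(3)]) (use mK in auto)
        also have "\<dots> \<le> ennreal ((2 + K) * (1 + block_phi 0 v ?m))"
        proof (rule ennreal_leI)
          have "(2 + K) * 1 \<le> (2 + K) * (1 + block_phi 0 v ?m)"
            using mK phi by (intro mult_left_mono) auto
          then show "1 + K \<le> (2 + K) * (1 + block_phi 0 v ?m)" by simp
        qed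
        finally show ?thesis using w by (simp add: ennreal_mult)
      next
        case False
        have "e \<le> 3 * A\<^sup>2 * R"
        proof -
          have "1 \<le> 3 * A\<^sup>2" using one_le_power[OF A, of 2] by linarith
          then have "1 * R \<le> 3 * A\<^sup>2 * R" using R by (intro mult_right_mono) auto
          then show ?thesis using e by linarith
        qed
        then have "ennreal r < qdiam X d"
          using False by (intro le_less_trans[OF ennreal_leI R(2)]) auto
        then have "ennreal ?m \<le> ennreal (C * r powr s)"
          unfolding em[symmetric] unfolding B using x by (intro ball_upper)
        then have "?m \<le> C * r powr s" using const_pos by simp
        also have "\<dots> \<le> C * e powr s"
          using False x const_pos by (intro mult_left_mono powr_mono2) auto
        also have "\<dots> \<le> t0" by (rule Ce)
        finally have wphi: "w \<le> block_phi 0 v ?m" using a(3) by (intro t0)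
        have "(\<integral>\<^sup>+y. ennreal (cmod (a y)) * ennreal (w * indicator E y) \<partial>M)
            \<le> (\<integral>\<^sup>+y. ennreal w * ennreal (cmod (a y)) \<partial>M)"
          using w by (intro nn_integral_mono) (auto split: split_indicator simp: mult.commute)
        also have "\<dots> = ennreal w * (\<integral>\<^sup>+y. ennreal (cmod (a y)) \<partial>M)"
          by (intro nn_integral_cmult) measurable
        also have "\<dots> \<le> ennreal w * ennreal 2"
          using block_L1_bound[OF blk p] by (intro mult_left_mono) auto
        also have "\<dots> = ennreal (w * 2)" using w by (subst ennreal_mult) auto
        also have "\<dots> \<le> ennreal ((2 + K) * (1 + block_phi 0 v ?m))"
        proof (rule ennreal_leI)
          have "w * 2 \<le> (1 + block_phi 0 v ?m) * 2" using wphi by simp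
          also have "\<dots> \<le> (1 + block_phi 0 v ?m) * (2 + K)"
            using phi mK by (intro mult_left_mono) auto
          finally show "w * 2 \<le> (2 + K) * (1 + block_phi 0 v ?m)" by (simp add: mult.commute)
        qed
        finally show ?thesis .
      qed
    qed
    then have "hump p v (2 + K) N E \<alpha> w"
      unfolding hump_def using E(1) \<alpha>(1) w(1) LlogL large by blast
    then show "\<exists>E \<alpha> w. hump p v (2 + K) N E \<alpha> w" by blast
  qed (use mK in simp)
qed

end

section \<open>Superposition of humps in the Orlicz class\<close>

text \<open>A supremum is taken instead of a sum: at each point its Orlicz integrand is controlled
  by that of a single height, hence by the series \<open>G\<close>, with no quasi-triangle
  inequality for the Orlicz class.\<close>

lemma LlogL_dominating_simple_functions:
  fixes E :: "nat \<Rightarrow> 'a set" and \<alpha> :: "nat \<Rightarrow> real" and b :: real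
  assumes b: "0 < b" and E: "\<And>n. E n \<in> sets M" and \<alpha>: "\<And>n. 0 < \<alpha> n"
    and fin: "(\<Sum>n. ennreal (\<alpha> n * ln (2 + \<alpha> n) powr b) * emeasure M (E n)) < \<infinity>"
  obtains f where "f \<in> LlogL_space M b"
    "\<And>n. AE x in M. x \<in> E n \<longrightarrow> \<alpha> n / 2 \<le> cmod (f x)"
proof -
  note [measurable] = E
  define F where "F x = (SUP n. ennreal (\<alpha> n) * indicator (E n) x)" for x
  define G where "G x = (\<Sum>n. ennreal (\<alpha> n * ln (2 + \<alpha> n) powr b) * indicator (E n) x)" for x
  \<comment> \<open>The factor \<open>1/2\<close> puts \<open>|f x|\<close> below some \<open>\<alpha> n\<close> with \<open>x \<in> E n\<close> even if the supremum is not attained.\<close>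
  define f where "f x = complex_of_real (enn2real (F x) / 2)" for x
  have [measurable]: "F \<in> borel_measurable M" "G \<in> borel_measurable M"
    unfolding F_def G_def by measurable
  have fm[measurable]: "f \<in> borel_measurable M" unfolding f_def by measurable
  have G: "(\<integral>\<^sup>+x. G x \<partial>M) < \<infinity>"
    unfolding G_def using fin by (subst nn_integral_suminf) (simp_all add: nn_integral_cmult_indicator)
  have Gn: "ennreal (\<alpha> n * ln (2 + \<alpha> n) powr b) * indicator (E n) x \<le> G x" for n x
  proof -
    have "h n \<le> suminf h" for h :: "nat \<Rightarrow> ennreal" using sum_le_suminf[of h "{n}"] by simp
    then show ?thesis unfolding G_def .
  qed
  have AEG: "AE x in M. G x < \<infinity>"
    using nn_integral_noteq_infinite[of G M] G by (auto simp: less_top)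
  have l2: "0 < ln 2 powr b" by simp
  \<comment> \<open>The logarithmic factor is at least \<open>ln 2 powr b\<close>, so every height
    is bounded by a fixed multiple of \<open>G x\<close>.\<close>
  have Ffin: "F x < \<infinity>" if "G x < \<infinity>" for x
  proof -
    have "F x \<le> ennreal (1 / ln 2 powr b) * G x"
      unfolding F_def
    proof (rule SUP_least)
      fix n
      have "\<alpha> n \<le> 1 / ln 2 powr b * (\<alpha> n * ln (2 + \<alpha> n) powr b)"
      proof -
        have "ln 2 powr b \<le> ln (2 + \<alpha> n) powr b"
          using b \<alpha>[of n] by (intro powr_mono2 ln_mono) auto
        then have "\<alpha> n * ln 2 powr b \<le> \<alpha> n * ln (2 + \<alpha> n) powr b"
          using \<alpha>[of n] by (intro mult_left_mono) auto
        then show ?thesis using l2 by (simp add: pos_le_divide_eq)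
      qed
      then have "ennreal (\<alpha> n) \<le> ennreal (1 / ln 2 powr b) * ennreal (\<alpha> n * ln (2 + \<alpha> n) powr b)"
        by (subst ennreal_mult'[symmetric]) (auto intro: ennreal_leI)
      then have "ennreal (\<alpha> n) * indicator (E n) x
          \<le> ennreal (1 / ln 2 powr b) * ennreal (\<alpha> n * ln (2 + \<alpha> n) powr b) * indicator (E n) x"
        by (rule mult_right_mono) simp
      also have "\<dots> \<le> ennreal (1 / ln 2 powr b) * G x"
        unfolding mult.assoc by (intro mult_left_mono Gn) simp
      finally show "ennreal (\<alpha> n) * indicator (E n) x \<le> ennreal (1 / ln 2 powr b) * G x" .
    qed
    also have "\<dots> < \<infinity>" using that by (simp add: ennreal_mult_less_top)
    finally show ?thesis .
  qed
  have fG: "ennreal (cmod (f x) * ln (2 + cmod (f x)) powr b) \<le> G x" if "G x < \<infinity>" for x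
  proof (cases "F x = 0")
    case False
    define y where "y = enn2real (F x)"
    have y: "F x = ennreal y" using Ffin[OF that] by (simp add: y_def)
    have y0: "y > 0" using False y by (metis ennreal_neg le_less_linear)
    have "ennreal (y / 2) < F x" using y y0 by (simp add: ennreal_lessI)
    then obtain n where n: "ennreal (y / 2) < ennreal (\<alpha> n) * indicator (E n) x"
      unfolding F_def by (auto simp: less_SUP_iff)
    then have xn: "x \<in> E n" and yn: "y / 2 \<le> \<alpha> n"
      using y0 \<alpha>[of n] by (auto simp: ennreal_less_iff split: split_indicator_asm)
    have fy: "cmod (f x) = y / 2" using y0 by (simp add: f_def y_def)
    have "cmod (f x) * ln (2 + cmod (f x)) powr b \<le> \<alpha> n * ln (2 + \<alpha> n) powr b"
      unfolding fy using yn y0 b by (intro mult_mono powr_mono2 ln_mono) auto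
    then have "ennreal (cmod (f x) * ln (2 + cmod (f x)) powr b)
        \<le> ennreal (\<alpha> n * ln (2 + \<alpha> n) powr b) * indicator (E n) x"
      using xn by (simp add: ennreal_leI)
    also have "\<dots> \<le> G x" by (rule Gn)
    finally show ?thesis .
  qed (simp add: f_def)
  show thesis
  proof
    have "(\<integral>\<^sup>+x. ennreal (cmod (f x) * ln (2 + cmod (f x)) powr b) \<partial>M) \<le> (\<integral>\<^sup>+x. G x \<partial>M)"
      using AEG by (intro nn_integral_mono_AE) (auto elim!: eventually_mono intro: fG)
    with G fm show "f \<in> LlogL_space M b" by (auto simp: LlogL_space_def)
    fix n
    show "AE x in M. x \<in> E n \<longrightarrow> \<alpha> n / 2 \<le> cmod (f x)"
      using AEG
    proof eventually_elim
      case (elim x)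
      show ?case
      proof
        assume x: "x \<in> E n"
        have "ennreal (\<alpha> n) * indicator (E n) x \<le> F x" unfolding F_def by (rule SUP_upper) simp
        then have "ennreal (\<alpha> n) \<le> F x" using x by simp
        then have "enn2real (ennreal (\<alpha> n)) \<le> enn2real (F x)"
          using Ffin[OF elim] by (intro enn2real_mono) auto
        then show "\<alpha> n / 2 \<le> cmod (f x)" using \<alpha>[of n] by (simp add: f_def)
      qed
    qed
  qed
qed

text \<open>With \<open>N = 2 ^ n\<close> the Orlicz integrals of the humps are summable, whereas
  membership of \<open>f\<close> in the block space would bound all pairings by the same
  \<open>K * S\<close>.\<close>

lemma (in ahlfors_regular) exists_LlogL_not_block_space:
  fixes q :: ereal and v :: real
  assumes q: "1 < q" and v: "v > -1"
    and x0: "x0 \<in> X" and R: "0 < R" "ennreal (3 * A\<^sup>2 * R) < qdiam X d"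
  shows "\<exists>f. f \<in> LlogL_space M (1 + v) \<and> f \<notin> block_space X d M q v"
proof -
  let ?b = "1 + v"
  obtain p where p: "p > 1"
    "\<And>X d (M :: 'a measure) B a. q_block X d M q B a \<Longrightarrow> space M = X \<Longrightarrow> B \<in> sets M \<Longrightarrow>
       power_block p M B a"
    using q_block_power_block[OF q] by blast
  obtain K where K: "K > 0" and ex: "\<And>N. 1 \<le> N \<Longrightarrow> \<exists>E \<alpha> w. hump p v K N E \<alpha> w"
    by (rule dispersed_hump[OF p(1) v x0 R], rule that)
  have "\<exists>E \<alpha> w. hump p v K (2 ^ n) E \<alpha> w" for n :: nat by (rule ex) simp
  then obtain E \<alpha> w where P: "\<And>n :: nat. hump p v K (2 ^ n) (E n) (\<alpha> n) (w n)" by metis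
  have E[measurable]: "E n \<in> sets M" and \<alpha>: "0 < \<alpha> n" and w: "0 < w n"
    and LlogL: "ennreal (\<alpha> n * ln (2 + \<alpha> n) powr ?b) * emeasure M (E n) \<le> ennreal (1 / 2 ^ n)"
    and large: "ennreal (2 ^ n) \<le> ennreal (\<alpha> n * w n) * emeasure M (E n)"
    and blk: "\<And>B a x r. power_block p M B a \<Longrightarrow> x \<in> X \<Longrightarrow> 0 < r \<Longrightarrow> B = qball X d x r \<Longrightarrow>
        (\<integral>\<^sup>+y. ennreal (cmod (a y)) * ennreal (w n * indicator (E n) y) \<partial>M)
          \<le> ennreal (K * (1 + block_phi 0 v (measure M B)))" for n
    using P[of n] unfolding hump_def by blast+
  have "(\<Sum>n. ennreal (\<alpha> n * ln (2 + \<alpha> n) powr ?b) * emeasure M (E n)) \<le> (\<Sum>n. ennreal ((1 / 2) ^ n))"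
    using LlogL by (intro suminf_le) (auto simp: power_one_over)
  also have "\<dots> = ennreal (\<Sum>n. (1 / 2) ^ n)"
    by (intro suminf_ennreal2 summable_geometric) auto
  also have "\<dots> < \<infinity>" by simp
  finally have "(\<Sum>n. ennreal (\<alpha> n * ln (2 + \<alpha> n) powr ?b) * emeasure M (E n)) < \<infinity>" .
  then obtain f where f: "f \<in> LlogL_space M ?b"
    "\<And>n. AE x in M. x \<in> E n \<longrightarrow> \<alpha> n / 2 \<le> cmod (f x)"
    using LlogL_dominating_simple_functions[of ?b E M \<alpha>] v E \<alpha> by auto
  have "f \<notin> block_space X d M q v"
  proof
    assume fB: "f \<in> block_space X d M q v"
    obtain S where S: "S \<ge> 0"
      "\<forall>w\<in>borel_measurable M. \<forall>K\<ge>0.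
        (\<forall>B a. q_block X d M q B a \<longrightarrow>
          (\<integral>\<^sup>+x. ennreal (cmod (a x)) * w x \<partial>M) \<le> ennreal (K * (1 + block_phi 0 v (measure M B)))) \<longrightarrow>
        (\<integral>\<^sup>+x. ennreal (cmod (f x)) * w x \<partial>M) \<le> ennreal (K * S)"
      by (rule block_space_weighted_integral_le[OF v fB], rule that)
    have upper: "(\<integral>\<^sup>+x. ennreal (cmod (f x)) * ennreal (w n * indicator (E n) x) \<partial>M) \<le> ennreal (K * S)" for n
    proof (rule S(2)[rule_format])
      fix B a assume a: "q_block X d M q B a"
      then obtain x r where B: "x \<in> X" "0 < r" "B = qball X d x r" by (auto simp: q_block_def)
      then have "power_block p M B a" using p(2)[OF a space_eq] ball_sets by simp
      then show "(\<integral>\<^sup>+x. ennreal (cmod (a x)) * ennreal (w n * indicator (E n) x) \<partial>M)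
          \<le> ennreal (K * (1 + block_phi 0 v (measure M B)))"
        using B by (rule blk)
    qed (use K in auto)
    have "2 ^ n \<le> 2 * (K * S)" for n
    proof -
      \<comment> \<open>The factor 2 makes up for \<open>f\<close> reaching only half of each
        height.\<close>
      have "ennreal (2 ^ n) \<le> ennreal (2 * (\<alpha> n / 2 * w n)) * emeasure M (E n)" using large[of n] by simp
      also have "\<dots> = ennreal 2 * (ennreal (\<alpha> n / 2 * w n) * emeasure M (E n))"
        using \<alpha>[of n] w[of n] by (subst ennreal_mult) (auto simp: mult.assoc)
      also have "ennreal (\<alpha> n / 2 * w n) * emeasure M (E n)
          = (\<integral>\<^sup>+x. ennreal (\<alpha> n / 2 * w n) * indicator (E n) x \<partial>M)"
        by (rule nn_integral_cmult_indicator[symmetric]) (rule E)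
      also have "\<dots> \<le> (\<integral>\<^sup>+x. ennreal (cmod (f x)) * ennreal (w n * indicator (E n) x) \<partial>M)"
      proof (rule nn_integral_mono_AE, use f(2)[of n] in eventually_elim)
        case (elim x)
        show ?case
        proof (cases "x \<in> E n")
          case True
          then have "\<alpha> n / 2 * w n \<le> cmod (f x) * w n"
            using elim w[of n] by (intro mult_right_mono) auto
          then show ?thesis using True w[of n] by (simp add: ennreal_mult[symmetric] ennreal_leI)
        qed simp
      qed
      also have "\<dots> \<le> ennreal (K * S)" by (rule upper)
      finally have "ennreal (2 ^ n) \<le> ennreal 2 * ennreal (K * S)" by (simp add: mult_left_mono)
      also have "\<dots> = ennreal (2 * (K * S))" using K S(1) by (subst ennreal_mult) auto
      finally show ?thesis using K S(1) by (subst (asm) ennreal_le_iff) auto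
    qed
    moreover obtain n where "2 * (K * S) < 2 ^ n" using real_arch_pow[of 2 "2 * (K * S)"] by auto
    ultimately show False by (meson not_less)
  qed
  with f(1) show ?thesis by blast
qed

section \<open>Extraction of the regularity constants and conclusion\<close>

lemma ahlfors_regular_qmms_ahlfors_regular:
  assumes "ahlfors_regular_qmms s X d M"
  obtains A c C where "ahlfors_regular X d M s A c C"
proof -
  have qm: "quasi_metric_on X d" and br: "borel_regular_on X d M" and s: "s > 0"
    and balls: "\<forall>x\<in>X. \<forall>r>0. qball X d x r \<in> sets M"
    using assms by (auto simp: ahlfors_regular_qmms_def)
  have "\<exists>A\<ge>1. \<forall>x\<in>X. \<forall>y\<in>X. \<forall>z\<in>X. d x y \<le> A * (d x z + d z y)"
    using qm unfolding quasi_metric_on_def by (rule conjunct2)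
  then obtain A where A: "A \<ge> 1" "\<forall>x\<in>X. \<forall>y\<in>X. \<forall>z\<in>X. d x y \<le> A * (d x z + d z y)" by auto
  have "\<exists>c>0. \<exists>C>0. \<forall>x\<in>X. \<forall>r>0. ennreal r < qdiam X d \<longrightarrow>
        ennreal (c * r powr s) \<le> emeasure M (qball X d x r) \<and>
        emeasure M (qball X d x r) \<le> ennreal (C * r powr s)"
    using assms by (simp add: ahlfors_regular_qmms_def)
  then obtain c C where c: "c > 0" "C > 0" "\<forall>x\<in>X. \<forall>r>0. ennreal r < qdiam X d \<longrightarrow>
        ennreal (c * r powr s) \<le> emeasure M (qball X d x r) \<and>
        emeasure M (qball X d x r) \<le> ennreal (C * r powr s)"
    by auto
  have "ahlfors_regular X d M s A c C"
    using qm br s balls A c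
    by unfold_locales (simp_all add: quasi_metric_on_def borel_regular_on_def)
  then show thesis by (rule that)
qed

theorem theorem1p4:
  fixes X :: "'a set" and d :: "'a \<Rightarrow> 'a \<Rightarrow> real" and M :: "'a measure"
    and s v :: real and q :: ereal
  assumes "ahlfors_regular_qmms s X d M"
    and "1 < q" and "v > -1"
  shows "block_space X d M q v \<subset> LlogL_space M (1 + v)"
proof -
  obtain A c C where "ahlfors_regular X d M s A c C"
    using ahlfors_regular_qmms_ahlfors_regular[OF assms(1)] by blast
  then interpret ahlfors_regular X d M s A c C .
  obtain x y where xy: "x \<in> X" "y \<in> X" "0 < d x y"
    using assms(1) unfolding ahlfors_regular_qmms_def quasi_metric_on_def
    by (metis order_le_less)
  \<comment> \<open>This makes \<open>3 * A^2 * R\<close> half of a positive distance, hence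
    strictly below the diameter, whether that is finite or infinite.\<close>
  define R where "R = d x y / (6 * A\<^sup>2)"
  have R: "0 < R" "3 * A\<^sup>2 * R = d x y / 2" using xy const_pos by (auto simp: R_def)
  have "ennreal (d x y / 2) < ennreal (d x y)" using xy by (intro ennreal_lessI) auto
  also have "\<dots> \<le> qdiam X d"
    unfolding qdiam_def using xy by (intro SUP_upper2[OF xy(1)] SUP_upper2[OF xy(2)] order_refl)
  finally have "ennreal (3 * A\<^sup>2 * R) < qdiam X d" by (simp only: R(2))
  then obtain f where "f \<in> LlogL_space M (1 + v)" "f \<notin> block_space X d M q v"
    using exists_LlogL_not_block_space[OF assms(2,3) xy(1) R(1)] by blast
  moreover have "block_space X d M q v \<subseteq> LlogL_space M (1 + v)"
    by (rule block_space_subset_LlogL[OF assms(3,2) space_eq ball_sets])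
  ultimately show ?thesis by blast
qed

end
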